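(* Let $(A,w)$ be a balanced full solution such that $supp_w(A)\geq \max_{c'\in C\setminus A} score_{(A,w)}(c')$. Then committee $A$ satisfies the PJR property and $(A,w)$ is a 3.15-factor approximation for the maximin support problem. Furthermore, testing the required conditions (feasibility of $w$, balancedness of $(A,w)$, and the inequality $supp_w(A)\geq \max_{c'\in C\setminus A} score_{(A,w)}(c')$) can be done in time $O(|E|)$. Finally, the output solution of the balanced greedy algorithm described below is guaranteed to satisfy these conditions.
   Context: Election instance: a bipartite approval graph $G=(N\cup C,E)$ with voters $N$ and candidates $C$ (no isolated vertices), vote strengths $s\in\mathbb{R}^N$, and a target committee size $0<k<|C|$. For $n\in N$, $C_n$ is the set of candidates approved by $n$; for $c\in C$, $N_c$ is the set of voters approving $c$. A solution is a pair $(A,w)$ with committee $A\subseteq C$, $|A|=k$ (full), and non-negative edge weights $w\in\mathbb{R}^E$; $w$ is feasible if $\sum_{c\in C_n} w_{nc}\leq s_n$ for every $n\in N$. Supports: $supp_w(c)=\sum_{n\in N_c} w_{nc}$ and $supp_w(A)=\min_{c\in A} supp_w(c)$ (with $supp_w(\emptyset)=\infty$). The maximin support problem asks to maximize $supp_w(A)$ over feasible full solutions. $(A,w)$ is balanced if $w$ is feasible, maximizes $\sum_{c\in A} supp_w(c)$ over feasible vectors, and among those minimizes $\sum_{c\in A} supp_w(c)^2$. PJR: committee $A$ of size $k$ satisfies PJR if there is no voter group $N'\subseteq N$ and integer $0<r\leq k$ with $\sum_{n\in N'} s_n\geq \frac{r}{k}\sum_{n\in N} s_n$, $|\cap_{n\in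 N'} C_n|\geq r$, and $|A\cap(\cup_{n\in N'} C_n)|<r$. For threshold $t\geq 0$: $slack_{(A,w)}(n,t)=s_n-\sum_{c\in A\cap C_n} w_{nc}\min\{1,t/supp_w(c)\}$; for $c'\in C\setminus A$, $prescore_{(A,w)}(c',t)=\sum_{n\in N_{c'}} slack_{(A,w)}(n,t)$ and $score_{(A,w)}(c')=\max\{t\geq 0: prescore_{(A,w)}(c',t)\geq t\}$. The balanced greedy algorithm: start with $A=\emptyset$, $w=0$; for $k$ iterations, find an unelected candidate $c_{\max}$ with the highest score $t_{\max}$, insert it by (for each voter $n\in N_{c_{\max}}$) scaling each $w_{nc}$, $c\in A\cap C_n$ with $supp_w(c)>t_{\max}$, by $t_{\max}/supp_w(c)$ and assigning $w_{nc_{\max}}=s_n-\sum_{c\in A\cap C_n} w_{nc}$ (new values), add $c_{\max}$ to $A$, and then replace $w$ with a balanced weight vector for $A$.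
   Formalization: Vote strengths are assumed non-negative with at least one positive: with a negative strength no feasible weights exist, and if all strengths are zero PJR can fail (two voters with disjoint ballots, k=1). *)

theory Defs
  imports Complex_Main
begin

section \<open>Elections\<close>

text \<open>Weights are total functions on pairs; only their values on \<^term>\<open>edges el\<close> matter.\<close>

record ('n, 'c) election =
  voters :: "'n set"
  cands :: "'c set"
  edges :: "('n \<times> 'c) set"
  strength :: "'n \<Rightarrow> real"
  csize :: nat

type_synonym ('n, 'c) weights = "'n \<times> 'c \<Rightarrow> real"

definition approved :: "('n, 'c) election \<Rightarrow> 'n \<Rightarrow> 'c set" where
  "approved el n = {c. (n, c) \<in> edges el}"

definition approvers :: "('n, 'c) election \<Rightarrow> 'c \<Rightarrow> 'n set" where
  "approvers el c = {n. (n, c) \<in> edges el}"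

text \<open>Some voter must have positive strength: otherwise every group of voters meets the
  entitlement bound of PJR, and PJR fails for trivial reasons.\<close>

definition election_instance :: "('n, 'c) election \<Rightarrow> bool" where
  "election_instance el \<longleftrightarrow>
     finite (voters el) \<and> finite (cands el) \<and> edges el \<subseteq> voters el \<times> cands el \<and>
     (\<forall>n\<in>voters el. approved el n \<noteq> {}) \<and> (\<forall>c\<in>cands el. approvers el c \<noteq> {}) \<and>
     (\<forall>n\<in>voters el. 0 \<le> strength el n) \<and> (\<exists>n\<in>voters el. 0 < strength el n) \<and>
     0 < csize el \<and> csize el < card (cands el)"

definition full :: "('n, 'c) election \<Rightarrow> 'c set \<Rightarrow> bool" where
  "full el A \<longleftrightarrow> A \<subseteq> cands el \<and> card A = csize el"

definition feasible :: "('n, 'c) election \<Rightarrow> ('n, 'c) weights \<Rightarrow> bool" where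
  "feasible el w \<longleftrightarrow>
     (\<forall>e\<in>edges el. 0 \<le> w e) \<and>
     (\<forall>n\<in>voters el. (\<Sum>c\<in>approved el n. w (n, c)) \<le> strength el n)"

definition supp :: "('n, 'c) election \<Rightarrow> ('n, 'c) weights \<Rightarrow> 'c \<Rightarrow> real" where
  "supp el w c = (\<Sum>n\<in>approvers el c. w (n, c))"

text \<open>The support of a committee; meaningful for nonempty committees only, in particular for
  all full ones.\<close>

definition min_supp :: "('n, 'c) election \<Rightarrow> ('n, 'c) weights \<Rightarrow> 'c set \<Rightarrow> real" where
  "min_supp el w A = Min (supp el w ` A)"

definition maximin_approx ::
  "('n, 'c) election \<Rightarrow> real \<Rightarrow> 'c set \<Rightarrow> ('n, 'c) weights \<Rightarrow> bool" where
  "maximin_approx el \<alpha> A w \<longleftrightarrow>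
     full el A \<and> feasible el w \<and>
     (\<forall>A' w'. full el A' \<and> feasible el w' \<longrightarrow> min_supp el w' A' \<le> \<alpha> * min_supp el w A)"

definition max_total_supp :: "('n, 'c) election \<Rightarrow> 'c set \<Rightarrow> ('n, 'c) weights \<Rightarrow> bool" where
  "max_total_supp el A w \<longleftrightarrow> is_arg_max (\<lambda>w. \<Sum>c\<in>A. supp el w c) (feasible el) w"

definition balanced :: "('n, 'c) election \<Rightarrow> 'c set \<Rightarrow> ('n, 'c) weights \<Rightarrow> bool" where
  "balanced el A w \<longleftrightarrow> is_arg_min (\<lambda>w. \<Sum>c\<in>A. (supp el w c)\<^sup>2) (max_total_supp el A) w"

definition PJR :: "('n, 'c) election \<Rightarrow> 'c set \<Rightarrow> bool" where
  "PJR el A \<longleftrightarrow>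
     \<not> (\<exists>N' r. N' \<subseteq> voters el \<and> 0 < r \<and> r \<le> csize el \<and>
          (\<Sum>n\<in>N'. strength el n) \<ge> real r / real (csize el) * (\<Sum>n\<in>voters el. strength el n) \<and>
          card (cands el \<inter> (\<Inter>n\<in>N'. approved el n)) \<ge> r \<and>
          card (A \<inter> (\<Union>n\<in>N'. approved el n)) < r)"


section \<open>Scores and the balanced greedy algorithm\<close>

text \<open>If \<^term>\<open>supp el w c = 0\<close> for non-negative \<open>w\<close>, then \<^term>\<open>w (n, c) = 0\<close>, so the value of
  the quotient below is irrelevant in that case.\<close>

definition slack ::
  "('n, 'c) election \<Rightarrow> 'c set \<Rightarrow> ('n, 'c) weights \<Rightarrow> 'n \<Rightarrow> real \<Rightarrow> real" where
  "slack el A w n t =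
     strength el n - (\<Sum>c\<in>A \<inter> approved el n. w (n, c) * min 1 (t / supp el w c))"

definition prescore ::
  "('n, 'c) election \<Rightarrow> 'c set \<Rightarrow> ('n, 'c) weights \<Rightarrow> 'c \<Rightarrow> real \<Rightarrow> real" where
  "prescore el A w c' t = (\<Sum>n\<in>approvers el c'. slack el A w n t)"

definition score :: "('n, 'c) election \<Rightarrow> 'c set \<Rightarrow> ('n, 'c) weights \<Rightarrow> 'c \<Rightarrow> real" where
  "score el A w c' = (GREATEST t. 0 \<le> t \<and> t \<le> prescore el A w c' t)"

definition score_condition :: "('n, 'c) election \<Rightarrow> 'c set \<Rightarrow> ('n, 'c) weights \<Rightarrow> bool" where
  "score_condition el A w \<longleftrightarrow> min_supp el w A \<ge> Max (score el A w ` (cands el - A))"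

definition scaled_weights ::
  "('n, 'c) election \<Rightarrow> ('n, 'c) weights \<Rightarrow> real \<Rightarrow> ('n, 'c) weights" where
  "scaled_weights el w t =
     (\<lambda>(n, c). if t < supp el w c then w (n, c) * (t / supp el w c) else w (n, c))"

definition insert_weights ::
  "('n, 'c) election \<Rightarrow> 'c set \<Rightarrow> ('n, 'c) weights \<Rightarrow> 'c \<Rightarrow> real \<Rightarrow> ('n, 'c) weights" where
  "insert_weights el A w cmax t =
     (\<lambda>(n, c).
        if n \<notin> approvers el cmax then w (n, c)
        else if c = cmax then
          strength el n - (\<Sum>d\<in>A \<inter> approved el n. scaled_weights el w t (n, d))
        else if c \<in> A \<inter> approved el n then scaled_weights el w t (n, c)
        else w (n, c))"

text \<open>The algorithm leaves open how ties between candidates are broken and which balanced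
  weight vector is taken, so one iteration is a relation between solutions.\<close>

definition insertion ::
  "('n, 'c) election \<Rightarrow> 'c set \<times> ('n, 'c) weights \<Rightarrow> 'c set \<times> ('n, 'c) weights \<Rightarrow> bool" where
  "insertion el = (\<lambda>(A, w) (A', w').
     \<exists>cmax\<in>cands el - A.
       (\<forall>c\<in>cands el - A. score el A w c \<le> score el A w cmax) \<and>
       A' = insert cmax A \<and>
       w' = insert_weights el A w cmax (score el A w cmax))"

definition rebalancing ::
  "('n, 'c) election \<Rightarrow> 'c set \<times> ('n, 'c) weights \<Rightarrow> 'c set \<times> ('n, 'c) weights \<Rightarrow> bool" where
  "rebalancing el = (\<lambda>(A, w) (A', w'). A' = A \<and> balanced el A w')"

definition greedy_output :: "('n, 'c) election \<Rightarrow> 'c set \<Rightarrow> ('n, 'c) weights \<Rightarrow> bool" where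
  "greedy_output el A w \<longleftrightarrow>
     ((insertion el OO rebalancing el) ^^ csize el) ({}, \<lambda>_. 0) (A, w)"


section \<open>A unit-cost real RAM\<close>

text \<open>While-programs over named arrays of natural numbers (used for indices, flags and counters)
  and named arrays of exact reals. A scalar variable is an array accessed at index 0. On naturals
  there is only addition and truncated subtraction; on reals there are the field operations and
  comparisons, with integer constants only and no rounding. Every node of an expression and every
  executed command costs one time unit.\<close>

type_synonym vname = string

datatype nexp =
    NConst nat
  | NRead vname nexp
  | NPlus nexp nexp
  | NMinus nexp nexp

datatype rexp =
    RConst int
  | RRead vname nexp
  | RPlus rexp rexp
  | RMinus rexp rexp
  | RTimes rexp rexp
  | RDivide rexp rexp

datatype bexp =
    NLess nexp nexp
  | RLess rexp rexp
  | BNot bexp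
  | BAnd bexp bexp

datatype com =
    Skip
  | NWrite vname nexp nexp
  | RWrite vname nexp rexp
  | Seq com com
  | Cond bexp com com
  | While bexp com

record state =
  nmem :: "vname \<Rightarrow> nat \<Rightarrow> nat"
  rmem :: "vname \<Rightarrow> nat \<Rightarrow> real"

primrec nval :: "nexp \<Rightarrow> state \<Rightarrow> nat" where
  "nval (NConst k) \<sigma> = k"
| "nval (NRead x i) \<sigma> = nmem \<sigma> x (nval i \<sigma>)"
| "nval (NPlus a b) \<sigma> = nval a \<sigma> + nval b \<sigma>"
| "nval (NMinus a b) \<sigma> = nval a \<sigma> - nval b \<sigma>"

primrec rval :: "rexp \<Rightarrow> state \<Rightarrow> real" where
  "rval (RConst k) \<sigma> = of_int k"
| "rval (RRead x i) \<sigma> = rmem \<sigma> x (nval i \<sigma>)"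
| "rval (RPlus a b) \<sigma> = rval a \<sigma> + rval b \<sigma>"
| "rval (RMinus a b) \<sigma> = rval a \<sigma> - rval b \<sigma>"
| "rval (RTimes a b) \<sigma> = rval a \<sigma> * rval b \<sigma>"
| "rval (RDivide a b) \<sigma> = rval a \<sigma> / rval b \<sigma>"

primrec bval :: "bexp \<Rightarrow> state \<Rightarrow> bool" where
  "bval (NLess a b) \<sigma> \<longleftrightarrow> nval a \<sigma> < nval b \<sigma>"
| "bval (RLess a b) \<sigma> \<longleftrightarrow> rval a \<sigma> < rval b \<sigma>"
| "bval (BNot b) \<sigma> \<longleftrightarrow> \<not> bval b \<sigma>"
| "bval (BAnd a b) \<sigma> \<longleftrightarrow> bval a \<sigma> \<and> bval b \<sigma>"

primrec ncost :: "nexp \<Rightarrow> nat" where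
  "ncost (NConst k) = 1"
| "ncost (NRead x i) = 1 + ncost i"
| "ncost (NPlus a b) = 1 + ncost a + ncost b"
| "ncost (NMinus a b) = 1 + ncost a + ncost b"

primrec rcost :: "rexp \<Rightarrow> nat" where
  "rcost (RConst k) = 1"
| "rcost (RRead x i) = 1 + ncost i"
| "rcost (RPlus a b) = 1 + rcost a + rcost b"
| "rcost (RMinus a b) = 1 + rcost a + rcost b"
| "rcost (RTimes a b) = 1 + rcost a + rcost b"
| "rcost (RDivide a b) = 1 + rcost a + rcost b"

primrec bcost :: "bexp \<Rightarrow> nat" where
  "bcost (NLess a b) = 1 + ncost a + ncost b"
| "bcost (RLess a b) = 1 + rcost a + rcost b"
| "bcost (BNot b) = 1 + bcost b"
| "bcost (BAnd a b) = 1 + bcost a + bcost b"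

definition nwrite :: "vname \<Rightarrow> nat \<Rightarrow> nat \<Rightarrow> state \<Rightarrow> state" where
  "nwrite x i v \<sigma> = \<sigma>\<lparr>nmem := (nmem \<sigma>)(x := (nmem \<sigma> x)(i := v))\<rparr>"

definition rwrite :: "vname \<Rightarrow> nat \<Rightarrow> real \<Rightarrow> state \<Rightarrow> state" where
  "rwrite x i v \<sigma> = \<sigma>\<lparr>rmem := (rmem \<sigma>)(x := (rmem \<sigma> x)(i := v))\<rparr>"

text \<open>\<open>exec p \<sigma> t \<sigma>'\<close>: started in \<open>\<sigma>\<close>, program \<open>p\<close> halts after \<open>t\<close> time units in \<open>\<sigma>'\<close>.\<close>

inductive exec :: "com \<Rightarrow> state \<Rightarrow> nat \<Rightarrow> state \<Rightarrow> bool" where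
  Skip: "exec Skip \<sigma> 1 \<sigma>"
| NWrite: "exec (NWrite x i a) \<sigma> (1 + ncost i + ncost a) (nwrite x (nval i \<sigma>) (nval a \<sigma>) \<sigma>)"
| RWrite: "exec (RWrite x i a) \<sigma> (1 + ncost i + rcost a) (rwrite x (nval i \<sigma>) (rval a \<sigma>) \<sigma>)"
| Seq: "exec p \<sigma> t \<sigma>' \<Longrightarrow> exec q \<sigma>' u \<sigma>'' \<Longrightarrow> exec (Seq p q) \<sigma> (1 + t + u) \<sigma>''"
| CondTrue: "bval b \<sigma> \<Longrightarrow> exec p \<sigma> t \<sigma>' \<Longrightarrow> exec (Cond b p q) \<sigma> (1 + bcost b + t) \<sigma>'"
| CondFalse: "\<not> bval b \<sigma> \<Longrightarrow> exec q \<sigma> t \<sigma>' \<Longrightarrow> exec (Cond b p q) \<sigma> (1 + bcost b + t) \<sigma>'"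
| WhileFalse: "\<not> bval b \<sigma> \<Longrightarrow> exec (While b p) \<sigma> (1 + bcost b) \<sigma>"
| WhileTrue: "bval b \<sigma> \<Longrightarrow> exec p \<sigma> t \<sigma>' \<Longrightarrow> exec (While b p) \<sigma>' u \<sigma>'' \<Longrightarrow>
    exec (While b p) \<sigma> (1 + bcost b + t + u) \<sigma>''"

inductive_cases exec_elims:
  "exec Skip \<sigma> t \<sigma>'"
  "exec (NWrite x i a) \<sigma> t \<sigma>'"
  "exec (RWrite x i a) \<sigma> t \<sigma>'"
  "exec (Seq p q) \<sigma> t \<sigma>'"
  "exec (Cond b p q) \<sigma> t \<sigma>'"
  "exec (While b p) \<sigma> t \<sigma>'"

lemma exec_deterministic:
  "exec p \<sigma> t \<sigma>' \<Longrightarrow> exec p \<sigma> u \<sigma>'' \<Longrightarrow> t = u \<and> \<sigma>' = \<sigma>''"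
proof (induction arbitrary: u \<sigma>'' rule: exec.induct)
  case (Skip \<sigma>)
  then show ?case by (rule exec_elims(1)) simp
next
  case (NWrite x i a \<sigma>)
  then show ?case by (rule exec_elims(2)) simp
next
  case (RWrite x i a \<sigma>)
  then show ?case by (rule exec_elims(3)) simp
next
  case (Seq p \<sigma> t \<sigma>' q u' \<tau>)
  from Seq.prems show ?case
  proof (rule exec_elims(4))
    fix t1 \<rho> t2
    assume "u = Suc (t1 + t2)" "exec p \<sigma> t1 \<rho>" "exec q \<rho> t2 \<sigma>''"
    then show ?thesis using Seq.IH(1)[of t1 \<rho>] Seq.IH(2)[of t2 \<sigma>''] by simp
  qed
next
  case (CondTrue b \<sigma> p t \<sigma>' q)
  from CondTrue.prems show ?case
  proof (rule exec_elims(5))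
    fix t1
    assume "u = Suc (bcost b + t1)" "exec p \<sigma> t1 \<sigma>''"
    then show ?thesis using CondTrue.IH[of t1 \<sigma>''] by simp
  qed (use CondTrue.hyps in simp)
next
  case (CondFalse b \<sigma> q t \<sigma>' p)
  from CondFalse.prems show ?case
  proof (rule exec_elims(5))
    fix t1
    assume "u = Suc (bcost b + t1)" "exec q \<sigma> t1 \<sigma>''"
    then show ?thesis using CondFalse.IH[of t1 \<sigma>''] by simp
  qed (use CondFalse.hyps in simp)
next
  case (WhileFalse b \<sigma> p)
  from WhileFalse.prems show ?case
    by (rule exec_elims(6)) (use WhileFalse.hyps in simp_all)
next
  case (WhileTrue b \<sigma> p t \<sigma>' u' \<tau>)
  from WhileTrue.prems show ?case
  proof (rule exec_elims(6))
    fix t1 \<rho> t2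
    assume "u = Suc (bcost b + t1 + t2)" "exec p \<sigma> t1 \<rho>" "exec (While b p) \<rho> t2 \<sigma>''"
    then show ?thesis using WhileTrue.IH(1)[of t1 \<rho>] WhileTrue.IH(2)[of t2 \<sigma>''] by simp
  qed (use WhileTrue.hyps in simp)
qed

text \<open>Voters, candidates and edges are numbered in an arbitrary order; the graph is given as an
  unsorted list of its edges and the committee by its indicator vector. All cells that are not
  mentioned may hold arbitrary values.\<close>

definition encodes ::
  "state \<Rightarrow> ('n, 'c) election \<Rightarrow> 'c set \<Rightarrow> ('n, 'c) weights \<Rightarrow> bool" where
  "encodes \<sigma> el A w \<longleftrightarrow>
     nmem \<sigma> ''voters'' 0 = card (voters el) \<and>
     nmem \<sigma> ''cands'' 0 = card (cands el) \<and>
     nmem \<sigma> ''edges'' 0 = card (edges el) \<and>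
     nmem \<sigma> ''csize'' 0 = csize el \<and>
     (\<exists>vt cd ed.
        bij_betw vt {..<card (voters el)} (voters el) \<and>
        bij_betw cd {..<card (cands el)} (cands el) \<and>
        bij_betw ed {..<card (edges el)} (edges el) \<and>
        (\<forall>i<card (voters el). rmem \<sigma> ''strength'' i = strength el (vt i)) \<and>
        (\<forall>j<card (cands el). nmem \<sigma> ''elected'' j = (if cd j \<in> A then 1 else 0)) \<and>
        (\<forall>l<card (edges el).
           nmem \<sigma> ''voter'' l < card (voters el) \<and>
           nmem \<sigma> ''cand'' l < card (cands el) \<and>
           ed l = (vt (nmem \<sigma> ''voter'' l), cd (nmem \<sigma> ''cand'' l)) \<and>
           rmem \<sigma> ''weight'' l = w (ed l)))"

definition accepts :: "state \<Rightarrow> bool" where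
  "accepts \<sigma> \<longleftrightarrow> nmem \<sigma> ''accept'' 0 = 1"

end

theory Submission
  imports Defs "HOL-Analysis.Function_Topology"
begin

text \<open>
  A feasible weight vector is balanced iff every voter with an approved committee member spends
  her whole strength on committee members of least support among those she approves. For a
  threshold \<open>t\<close> her slack is therefore \<open>s\<^sub>n (1 - t / max t p\<^sub>n)\<close>, where \<open>p\<^sub>n\<close> is that least support.

  Approximation. Let \<open>(B, v)\<close> be a full solution with all supports at least \<open>\<tau>\<close>, let \<open>t = \<tau> / 3\<close>
  and \<open>m = |B - A| = |A - B|\<close>. Bound the sum of the prescores at \<open>t\<close> over \<open>B - A\<close> from below,
  counting only the weight that \<open>v\<close> gives to \<open>B - A\<close>; this weight is at least \<open>m \<tau>\<close>. Of the weight
  of voters with \<open>p\<^sub>n > \<tau>\<close> at most a third is lost. Voters with \<open>p\<^sub>n \<le> \<tau>\<close> carry the whole support of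
  the committee members of support at most \<open>\<tau>\<close>, but those among them that lie in \<open>B\<close> absorb at
  least as much in \<open>v\<close>, which leaves a loss of at most \<open>t\<close> for each member of \<open>A - B\<close>. Some
  prescore at \<open>t\<close> is thus at least \<open>t\<close>, so the score condition forces the support of \<open>A\<close> to be
  at least \<open>t\<close>. This gives the factor 3, which is better than 3.15.

  PJR. With \<open>T\<close> the support of \<open>A\<close>, \<open>S\<close> the total strength and \<open>k\<close> the committee size, a violating
  group leaves some approved unelected candidate a prescore of at least
  \<open>r S / k - (r - 1) T \<ge> S / k \<ge> T\<close> at \<open>T\<close>. The score condition then forces \<open>T = S / k\<close>, in which
  case all slacks at \<open>T\<close> vanish and this prescore is \<open>0\<close>.

  Linear time. The prescore is antitone in the threshold and the score is its fixed point, so a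
  score is at most \<open>t\<close> iff the prescore at \<open>t\<close> is at most \<open>t\<close>; only one threshold, the support of
  the committee, has to be tested.

  Greedy. When a balanced committee grows, the supports of its members decrease, hence so do all
  slacks and scores; inserting the candidate of highest score keeps the least support above
  that score.
\<close>

section \<open>Elementary facts about election instances\<close>

locale approval_election =
  fixes el :: "('n, 'c) election"
  assumes instance_el: "election_instance el"
begin

lemma finite_voters: "finite (voters el)" and finite_cands: "finite (cands el)"
  and edges_subset: "edges el \<subseteq> voters el \<times> cands el"
  and strength_nonneg: "n \<in> voters el \<Longrightarrow> 0 \<le> strength el n"
  and csize_pos: "0 < csize el" and csize_less: "csize el < card (cands el)"
  using instance_el by (auto simp: election_instance_def)

lemma approved_subset: "approved el n \<subseteq> cands el"
  using edges_subset by (auto simp: approved_def)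

lemma approvers_subset: "approvers el c \<subseteq> voters el"
  using edges_subset by (auto simp: approvers_def)

lemma finite_approved [simp]: "finite (approved el n)"
  using approved_subset finite_cands finite_subset by blast

lemma finite_approvers [simp]: "finite (approvers el c)"
  using approvers_subset finite_voters finite_subset by blast

lemma finite_edges: "finite (edges el)"
  using edges_subset finite_voters finite_cands finite_subset by blast

lemma approved_iff_approvers: "c \<in> approved el n \<longleftrightarrow> n \<in> approvers el c"
  by (simp add: approved_def approvers_def)

lemma in_approvers_voter: "n \<in> approvers el c \<Longrightarrow> n \<in> voters el"
  using approvers_subset by blast

lemma in_approved_voter: "c \<in> approved el n \<Longrightarrow> n \<in> voters el"
  using edges_subset by (auto simp: approved_def)

lemma finite_committee: "A \<subseteq> cands el \<Longrightarrow> finite A"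
  using finite_cands finite_subset by blast

lemma total_strength_pos: "0 < (\<Sum>n\<in>voters el. strength el n)"
proof -
  obtain n where "n \<in> voters el" "0 < strength el n"
    using instance_el by (auto simp: election_instance_def)
  then show ?thesis
    using finite_voters strength_nonneg by (intro sum_pos2[of _ n]) auto
qed

text \<open>Double counting of the edges that end in \<open>A\<close>. It turns statements about
  supports of candidates into statements about what each voter spends, and back.\<close>

lemma sum_cands_voters_swap:
  assumes "A \<subseteq> cands el"
  shows "(\<Sum>c\<in>A. \<Sum>n\<in>approvers el c. h n c) = (\<Sum>n\<in>voters el. \<Sum>c\<in>A \<inter> approved el n. h n c)"
proof -
  have "approvers el c = {n \<in> voters el. (n, c) \<in> edges el}" for c
    using approvers_subset by (auto simp: approvers_def)
  moreover have "A \<inter> approved el n = {c \<in> A. (n, c) \<in> edges el}" for n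
    by (auto simp: approved_def)
  ultimately show ?thesis
    using sum.swap_restrict[OF finite_committee[OF assms] finite_voters] by simp
qed

lemma total_supp:
  assumes "A \<subseteq> cands el"
  shows "(\<Sum>c\<in>A. supp el w c) = (\<Sum>n\<in>voters el. \<Sum>c\<in>A \<inter> approved el n. w (n, c))"
  unfolding supp_def by (rule sum_cands_voters_swap[OF assms])


section \<open>Feasible weights\<close>

lemma feasible_nonneg: "feasible el w \<Longrightarrow> n \<in> approvers el c \<Longrightarrow> 0 \<le> w (n, c)"
  by (auto simp: feasible_def approvers_def)

lemma feasible_nonneg': "feasible el w \<Longrightarrow> c \<in> approved el n \<Longrightarrow> 0 \<le> w (n, c)"
  by (auto simp: feasible_def approved_def)

lemma feasible_sum_le:
  assumes "feasible el w" "n \<in> voters el" "B \<subseteq> approved el n"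
  shows "(\<Sum>c\<in>B. w (n, c)) \<le> strength el n"
proof -
  have "(\<Sum>c\<in>B. w (n, c)) \<le> (\<Sum>c\<in>approved el n. w (n, c))"
    using assms by (intro sum_mono2) (auto intro: feasible_nonneg')
  then show ?thesis using assms by (force simp: feasible_def)
qed

lemma feasible_le_strength:
  assumes "feasible el w" "c \<in> approved el n"
  shows "w (n, c) \<le> strength el n"
  using feasible_sum_le[of w n "{c}"] assms in_approved_voter by simp

lemma supp_nonneg: "feasible el w \<Longrightarrow> 0 \<le> supp el w c"
  unfolding supp_def by (intro sum_nonneg) (rule feasible_nonneg)

lemma weight_le_supp: "feasible el w \<Longrightarrow> n \<in> approvers el c \<Longrightarrow> w (n, c) \<le> supp el w c"
  unfolding supp_def by (rule member_le_sum) (auto intro: feasible_nonneg)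


section \<open>Balanced weights\<close>

text \<open>Combinatorial counterpart of \<open>max_total_supp\<close>. A voter who approves nobody
  in \<open>A\<close> only has to stay within her budget, since her weight enters no support of a
  member of \<open>A\<close>.\<close>

definition exhaustive :: "'c set \<Rightarrow> ('n, 'c) weights \<Rightarrow> bool" where
  "exhaustive A w \<longleftrightarrow> feasible el w \<and> (\<forall>n\<in>voters el. A \<inter> approved el n \<noteq> {} \<longrightarrow>
     (\<Sum>c\<in>A \<inter> approved el n. w (n, c)) = strength el n)"

text \<open>Local optimality for the sum of squares: no voter has weight that she could move to a
  less supported member of \<open>A\<close>.\<close>

definition concentrated :: "'c set \<Rightarrow> ('n, 'c) weights \<Rightarrow> bool" where
  "concentrated A w \<longleftrightarrow> (\<forall>n. \<forall>c\<in>A \<inter> approved el n. \<forall>d\<in>A \<inter> approved el n.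
     0 < w (n, c) \<longrightarrow> supp el w c \<le> supp el w d)"

text \<open>Each voter puts her whole strength on one approved member of \<open>A\<close>. The
  vanishing outside the edges is recorded because the compactness argument in
  \<open>balanced_exists\<close> works with all coordinates.\<close>

lemma exhaustive_exists: "\<exists>w. exhaustive A w \<and> (\<forall>e. e \<notin> edges el \<longrightarrow> w e = 0)"
proof -
  define pick where "pick n = (SOME c. c \<in> A \<inter> approved el n)" for n
  define w where "w = (\<lambda>(n, c). if A \<inter> approved el n \<noteq> {} \<and> c = pick n then strength el n else 0)"
  have pick: "pick n \<in> A \<inter> approved el n" if "A \<inter> approved el n \<noteq> {}" for n
    unfolding pick_def using that by (metis some_in_eq)
  have sums: "(\<Sum>c\<in>B. w (n, c)) = strength el n"
    if "A \<inter> approved el n \<noteq> {}" "finite B" "A \<inter> approved el n \<subseteq> B" for n B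
  proof -
    have "(\<Sum>c\<in>B. w (n, c)) = (\<Sum>c\<in>B. if c = pick n then strength el n else 0)"
      using that by (intro sum.cong) (auto simp: w_def)
    then show ?thesis using that pick[of n] by auto
  qed
  have "(\<Sum>c\<in>approved el n. w (n, c)) \<le> strength el n" if "n \<in> voters el" for n
  proof (cases "A \<inter> approved el n = {}")
    case True
    then show ?thesis using strength_nonneg[OF that] by (simp add: w_def)
  next
    case False
    then show ?thesis using sums[of n "approved el n"] by simp
  qed
  moreover have "0 \<le> w e" if "e \<in> edges el" for e
    using that edges_subset strength_nonneg by (auto simp: w_def split: prod.split)
  ultimately have "feasible el w" by (simp add: feasible_def)
  moreover have "w e = 0" if "e \<notin> edges el" for e
    using that pick by (fastforce simp: w_def approved_def split: prod.split)
  ultimately show ?thesis using sums by (intro exI[of _ w]) (simp add: exhaustive_def)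
qed

text \<open>The total support is bounded voter by voter by \<open>cov\<close>, and exhaustive
  vectors attain the bound. A maximizer therefore has equality in the sum of these bounds, hence in
  each of them.\<close>

lemma max_total_supp_iff_exhaustive:
  assumes A: "A \<subseteq> cands el"
  shows "max_total_supp el A w \<longleftrightarrow> exhaustive A w"
proof -
  define cov where "cov n = (if A \<inter> approved el n = {} then 0 else strength el n)" for n
  have le: "(\<Sum>c\<in>A \<inter> approved el n. v (n, c)) \<le> cov n" if "feasible el v" "n \<in> voters el" for v n
    using feasible_sum_le[OF that, of "A \<inter> approved el n"] by (auto simp: cov_def)
  have bound: "(\<Sum>c\<in>A. supp el v c) \<le> (\<Sum>n\<in>voters el. cov n)" if "feasible el v" for v
    unfolding total_supp[OF A] using le[OF that] by (intro sum_mono)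
  have attained: "(\<Sum>c\<in>A. supp el v c) = (\<Sum>n\<in>voters el. cov n)" if "exhaustive A v" for v
    unfolding total_supp[OF A] using that by (intro sum.cong) (auto simp: cov_def exhaustive_def)
  obtain v where v: "exhaustive A v" using exhaustive_exists by blast
  show ?thesis
  proof
    assume "max_total_supp el A w"
    then have f: "feasible el w" and "\<not> (\<Sum>c\<in>A. supp el w c) < (\<Sum>c\<in>A. supp el v c)"
      using v by (auto simp: max_total_supp_def is_arg_max_def exhaustive_def)
    then have "(\<Sum>n\<in>voters el. \<Sum>c\<in>A \<inter> approved el n. w (n, c)) = (\<Sum>n\<in>voters el. cov n)"
      using bound[OF f] attained[OF v] total_supp[OF A, of w] by linarith
    then have "(\<Sum>c\<in>A \<inter> approved el n. w (n, c)) = cov n" if "n \<in> voters el" for n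
      using sum_mono_inv[of "\<lambda>n. \<Sum>c\<in>A \<inter> approved el n. w (n, c)" "voters el" cov, OF _ le[OF f] that finite_voters] by simp
    then show "exhaustive A w" using f by (auto simp: exhaustive_def cov_def)
  next
    assume w: "exhaustive A w"
    show "max_total_supp el A w"
      unfolding max_total_supp_def is_arg_max_def
      using w bound attained[OF w] by (force simp: exhaustive_def)
  qed
qed

text \<open>Exchange argument: if a voter supports \<open>c\<close> although she approves a less
  supported \<open>d\<close>, moving a little weight from \<open>c\<close> to \<open>d\<close> keeps
  the vector exhaustive and lowers the sum of squares.\<close>

lemma balanced_concentrated:
  assumes A: "A \<subseteq> cands el" and bal: "balanced el A w"
  shows "concentrated A w"
proof (rule ccontr)
  assume "\<not> concentrated A w"
  then obtain n c d where c: "c \<in> A" "c \<in> approved el n" and d: "d \<in> A" "d \<in> approved el n"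
    and pos: "0 < w (n, c)" and less: "supp el w d < supp el w c"
    by (force simp: concentrated_def)
  have exh: "exhaustive A w"
    using bal by (simp add: balanced_def is_arg_min_def max_total_supp_iff_exhaustive[OF A])
  then have f: "feasible el w" by (simp add: exhaustive_def)
  \<comment> \<open>At most \<open>w (n, c)\<close> to keep the weight of \<open>c\<close>
    non-negative, and at most half the gap between the two supports, so that the change
    \<open>2 * e * (e - gap)\<close> of the sum of squares is negative.\<close>
  define e where "e = min (w (n, c)) ((supp el w c - supp el w d) / 2)"
  have e: "0 < e" "e \<le> w (n, c)" "2 * e \<le> supp el w c - supp el w d"
    using pos less by (auto simp: e_def min_def)
  have "c \<noteq> d" using less by auto
  define v where "v = w((n, c) := w (n, c) - e, (n, d) := w (n, d) + e)"
  have v: "v (m, b) = w (m, b) + (if m = n \<and> b = d then e else 0) - (if m = n \<and> b = c then e else 0)"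
    for m b using \<open>c \<noteq> d\<close> by (auto simp: v_def)
  have sums: "(\<Sum>b\<in>B. v (m, b)) = (\<Sum>b\<in>B. w (m, b))" if "finite B" "c \<in> B" "d \<in> B" for m B
    using that by (cases "m = n") (auto simp: v sum.distrib sum_subtractf)
  have sums': "(\<Sum>b\<in>B. v (m, b)) = (\<Sum>b\<in>B. w (m, b))" if "m \<noteq> n" for m B
    using that by (simp add: v)
  have "0 \<le> v x" if "x \<in> edges el" for x
    using that f e by (auto simp: v_def feasible_def add_nonneg_nonneg)
  moreover have "(\<Sum>b\<in>approved el m. v (m, b)) \<le> strength el m" if "m \<in> voters el" for m
    using feasible_sum_le[OF f that order_refl] sums[of "approved el n" m] sums' c d by (cases "m = n") auto
  ultimately have fv: "feasible el v" by (simp add: feasible_def)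
  have "(\<Sum>b\<in>A \<inter> approved el m. v (m, b)) = (\<Sum>b\<in>A \<inter> approved el m. w (m, b))" for m
    using sums[of "A \<inter> approved el n" m] sums' c d by (cases "m = n") auto
  then have "exhaustive A v" using exh fv by (simp add: exhaustive_def)
  then have not_less: "\<not> (\<Sum>c\<in>A. (supp el v c)\<^sup>2) < (\<Sum>c\<in>A. (supp el w c)\<^sup>2)"
    using bal by (auto simp: balanced_def is_arg_min_def max_total_supp_iff_exhaustive[OF A])
  have nc: "n \<in> approvers el c" "n \<in> approvers el d" using c d by (auto simp: approved_iff_approvers)
  have sv: "supp el v b = supp el w b + (if b = d then e else 0) - (if b = c then e else 0)" for b
    using nc by (auto simp: supp_def v sum.distrib sum_subtractf)
  have split: "(\<Sum>b\<in>A. g b) = g c + g d + (\<Sum>b\<in>A - {c, d}. g b)" for g :: "'c \<Rightarrow> real"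
    using c d \<open>c \<noteq> d\<close> finite_committee[OF A] sum.subset_diff[of "{c, d}" A g] by simp
  have "(\<Sum>b\<in>A. (supp el v b)\<^sup>2) - (\<Sum>b\<in>A. (supp el w b)\<^sup>2) =
      (supp el w c - e)\<^sup>2 + (supp el w d + e)\<^sup>2 - (supp el w c)\<^sup>2 - (supp el w d)\<^sup>2"
    unfolding split using \<open>c \<noteq> d\<close> by (simp add: sv)
  also have "\<dots> = 2 * e * (e - (supp el w c - supp el w d))"
    by (simp add: power2_eq_square algebra_simps)
  also have "\<dots> < 0" using e by (intro mult_pos_neg) auto
  finally show False using not_less by simp
qed

text \<open>First-order optimality for a convex objective. With the supports under \<open>w\<close>
  taken as prices, every voter spends her budget under \<open>w\<close> at the lowest price open to
  her, so no exhaustive \<open>v\<close> is cheaper; the second-order term is a sum of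
  squares.\<close>

lemma exhaustive_concentrated_balanced:
  assumes A: "A \<subseteq> cands el" and exh: "exhaustive A w" and conc: "concentrated A w"
  shows "balanced el A w"
proof -
  have "(\<Sum>c\<in>A. (supp el w c)\<^sup>2) \<le> (\<Sum>c\<in>A. (supp el v c)\<^sup>2)" if v: "exhaustive A v" for v
  proof -
    have voter: "(\<Sum>c\<in>A \<inter> approved el n. supp el w c * w (n, c))
        \<le> (\<Sum>c\<in>A \<inter> approved el n. supp el w c * v (n, c))" if n: "n \<in> voters el" for n
    proof (cases "A \<inter> approved el n = {}")
      case False
      define p where "p = Min (supp el w ` (A \<inter> approved el n))"
      have p: "p \<le> supp el w c" if "c \<in> A \<inter> approved el n" for c
        using that by (simp add: p_def)
      have "p \<in> supp el w ` (A \<inter> approved el n)"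
        unfolding p_def using False by (intro Min_in) auto
      then obtain d where d: "d \<in> A \<inter> approved el n" "supp el w d = p" by auto
      have eq: "supp el w c * w (n, c) = p * w (n, c)" if c: "c \<in> A \<inter> approved el n" for c
      proof (cases "0 < w (n, c)")
        case True
        then have "supp el w c \<le> p" using conc c d by (auto simp: concentrated_def)
        then show ?thesis using p[OF c] by simp
      next
        case False
        then show ?thesis using feasible_nonneg'[of w c n] exh c by (auto simp: exhaustive_def)
      qed
      have "(\<Sum>c\<in>A \<inter> approved el n. supp el w c * w (n, c)) = (\<Sum>c\<in>A \<inter> approved el n. p * w (n, c))"
        using eq by (rule sum.cong[OF refl])
      also have "\<dots> = p * strength el n"
        using exh n False by (simp add: exhaustive_def sum_distrib_left[symmetric])
      also have "\<dots> = (\<Sum>c\<in>A \<inter> approved el n. p * v (n, c))"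
        using v n False by (simp add: exhaustive_def sum_distrib_left[symmetric])
      also have "\<dots> \<le> (\<Sum>c\<in>A \<inter> approved el n. supp el w c * v (n, c))"
        using p v by (intro sum_mono mult_right_mono) (auto simp: exhaustive_def intro: feasible_nonneg')
      finally show ?thesis .
    qed (simp only: sum.empty)
    have inner: "(\<Sum>c\<in>A. supp el w c * supp el u c) =
        (\<Sum>n\<in>voters el. \<Sum>c\<in>A \<inter> approved el n. supp el w c * u (n, c))" for u
      using sum_cands_voters_swap[OF A, of "\<lambda>n c. supp el w c * u (n, c)"]
      by (simp add: supp_def sum_distrib_left)
    have "(\<Sum>c\<in>A. supp el w c * supp el w c) \<le> (\<Sum>c\<in>A. supp el w c * supp el v c)"
      unfolding inner using voter by (rule sum_mono)
    \<comment> \<open>Expansion of the squared distance between the support vectors of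
      \<open>v\<close> and \<open>w\<close> around \<open>w\<close>.\<close>
    moreover have "(\<Sum>c\<in>A. (supp el v c)\<^sup>2) - (\<Sum>c\<in>A. (supp el w c)\<^sup>2) -
        2 * (\<Sum>c\<in>A. supp el w c * supp el v c) + 2 * (\<Sum>c\<in>A. supp el w c * supp el w c) =
        (\<Sum>c\<in>A. (supp el v c - supp el w c)\<^sup>2)"
      by (simp add: power2_diff sum.distrib sum_subtractf power2_eq_square sum_distrib_left algebra_simps)
    moreover have "0 \<le> (\<Sum>c\<in>A. (supp el v c - supp el w c)\<^sup>2)"
      by (intro sum_nonneg) simp
    ultimately show ?thesis by linarith
  qed
  then show ?thesis
    using exh by (auto simp: balanced_def is_arg_min_def max_total_supp_iff_exhaustive[OF A] not_less)
qed

lemma balanced_iff: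
  assumes "A \<subseteq> cands el"
  shows "balanced el A w \<longleftrightarrow> exhaustive A w \<and> concentrated A w"
  using balanced_concentrated[OF assms] exhaustive_concentrated_balanced[OF assms]
  by (auto simp: balanced_def is_arg_min_def max_total_supp_iff_exhaustive[OF assms])

text \<open>Ensures that rebalancing always has a result. The sum of squares is continuous in the
  product topology and attains its minimum on the exhaustive vectors in the box of weights between 0
  and the total strength, which is compact by Tychonoff.\<close>

lemma balanced_exists:
  assumes A: "A \<subseteq> cands el"
  shows "\<exists>w. balanced el A w"
proof -
  define S where "S = (\<Sum>n\<in>voters el. strength el n)"
  define X where "X = PiE UNIV (\<lambda>_ :: 'n \<times> 'c. {0..S}) \<inter> Collect (exhaustive A)"
  have coord: "continuous_on U (\<lambda>w :: ('n, 'c) weights. w e)" for U e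
    by (intro continuous_on_subset[OF continuous_on_product_coordinates]) simp
  have cont_supp: "continuous_on U (\<lambda>w. supp el w c)" for U c
    unfolding supp_def by (intro continuous_intros coord)
  have "compact (PiE UNIV (\<lambda>_ :: 'n \<times> 'c. {0..S}))"
    using compactin_PiE[of "\<lambda>_ :: 'n \<times> 'c. euclideanreal" UNIV "\<lambda>_. {0..S}"]
    by (simp add: euclidean_product_topology)
  moreover have "closed (Collect (exhaustive A))"
  proof -
    have "Collect (exhaustive A) = (\<Inter>e\<in>edges el. {w. 0 \<le> w e}) \<inter>
      (\<Inter>n\<in>voters el. {w. (\<Sum>c\<in>approved el n. w (n, c)) \<le> strength el n}) \<inter>
      (\<Inter>n\<in>{n \<in> voters el. A \<inter> approved el n \<noteq> {}}.
         {w. (\<Sum>c\<in>A \<inter> approved el n. w (n, c)) = strength el n})"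
      by (simp add: set_eq_iff exhaustive_def feasible_def) blast
    also have "closed \<dots>"
      by (intro closed_Int closed_INT ballI closed_Collect_le closed_Collect_eq continuous_intros coord)
    finally show ?thesis .
  qed
  ultimately have "compact X" unfolding X_def by (rule compact_Int_closed)
  moreover have inX: "w \<in> X" if "exhaustive A w" "\<forall>e. e \<notin> edges el \<longrightarrow> w e = 0" for w
  proof -
    have "0 \<le> w (n, c) \<and> w (n, c) \<le> S" for n c
    proof (cases "(n, c) \<in> edges el")
      case True
      then have c: "c \<in> approved el n" by (simp add: approved_def)
      have f: "feasible el w" using that by (simp add: exhaustive_def)
      have "w (n, c) \<le> strength el n" using feasible_le_strength[OF f c] .
      also have "\<dots> \<le> S" unfolding S_def
        using finite_voters strength_nonneg in_approved_voter[OF c] by (intro member_le_sum) auto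
      finally show ?thesis using feasible_nonneg'[OF f c] by simp
    next
      case False
      then show ?thesis using that total_strength_pos by (simp add: S_def)
    qed
    then show ?thesis using that by (auto simp: X_def)
  qed
  moreover have "X \<noteq> {}" using exhaustive_exists[of A] inX by blast
  ultimately obtain w where w: "w \<in> X"
    and min: "\<And>v. v \<in> X \<Longrightarrow> (\<Sum>c\<in>A. (supp el w c)\<^sup>2) \<le> (\<Sum>c\<in>A. (supp el v c)\<^sup>2)"
    using continuous_attains_inf[of X "\<lambda>w. \<Sum>c\<in>A. (supp el w c)\<^sup>2"]
    by (force intro!: continuous_intros cont_supp)
  have "(\<Sum>c\<in>A. (supp el w c)\<^sup>2) \<le> (\<Sum>c\<in>A. (supp el v c)\<^sup>2)" if v: "exhaustive A v" for v
  proof -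
    \<comment> \<open>A competitor \<open>v\<close> may be arbitrary outside the edges. Clearing
      those coordinates moves it into the box without changing any support.\<close>
    define u where "u e = (if e \<in> edges el then v e else 0)" for e
    have "supp el u = supp el v"
      by (auto simp: supp_def u_def approvers_def intro!: sum.cong)
    moreover have "(\<Sum>c\<in>B. u (n, c)) = (\<Sum>c\<in>B. v (n, c))" if "B \<subseteq> approved el n" for B n
      using that by (auto simp: u_def approved_def intro!: sum.cong)
    then have "exhaustive A u" using v by (simp add: exhaustive_def feasible_def u_def)
    then have "u \<in> X" by (intro inX) (auto simp: u_def)
    ultimately show ?thesis using min by fastforce
  qed
  then show ?thesis
    using w by (auto simp: balanced_def is_arg_min_def max_total_supp_iff_exhaustive[OF A] not_less X_def)
qed


section \<open>Scores\<close>

lemma slack_nonneg: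
  assumes "feasible el w" "n \<in> voters el"
  shows "0 \<le> slack el A w n t"
proof -
  have "(\<Sum>c\<in>A \<inter> approved el n. w (n, c) * min 1 (t / supp el w c)) \<le> (\<Sum>c\<in>A \<inter> approved el n. w (n, c))"
    using assms by (intro sum_mono mult_left_le) (auto intro: feasible_nonneg')
  also have "\<dots> \<le> strength el n" using assms by (intro feasible_sum_le) auto
  finally show ?thesis by (simp add: slack_def)
qed

lemma slack_antimono:
  assumes "feasible el w" "s \<le> t"
  shows "slack el A w n t \<le> slack el A w n s"
  unfolding slack_def using assms supp_nonneg[OF assms(1)]
  by (intro diff_left_mono sum_mono mult_left_mono min.mono divide_right_mono)
     (auto intro: feasible_nonneg')

lemma prescore_antimono:
  assumes "feasible el w" "s \<le> t"
  shows "prescore el A w c t \<le> prescore el A w c s"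
  unfolding prescore_def by (intro sum_mono slack_antimono assms)

lemma continuous_on_prescore: "continuous_on U (prescore el A w c)"
  \<comment> \<open>With the quotient written as a product with \<open>inverse\<close>, continuity
    in the threshold needs no case distinction on a zero support.\<close>
  unfolding prescore_def slack_def divide_inverse by (intro continuous_intros)

text \<open>The prescore is continuous and antitone, so the intermediate value theorem gives a fixed
  point between 0 and the prescore at 0. Antitonicity makes it the greatest admissible threshold, so
  that \<open>GREATEST\<close> in \<open>score\<close> really denotes a maximum.\<close>

lemma score_fixpoint:
  assumes w: "feasible el w"
  shows "prescore el A w c (score el A w c) = score el A w c" "0 \<le> score el A w c"
proof -
  define M where "M = prescore el A w c 0"
  have "0 \<le> M"
    unfolding M_def prescore_def by (intro sum_nonneg slack_nonneg w in_approvers_voter)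
  moreover have "prescore el A w c M \<le> M"
    using prescore_antimono[OF w \<open>0 \<le> M\<close>] by (simp add: M_def)
  ultimately have "\<exists>t\<ge>0. t \<le> M \<and> t - prescore el A w c t = 0"
    by (intro IVT') (auto simp: M_def intro!: continuous_intros continuous_on_prescore)
  then obtain t where t: "0 \<le> t" "prescore el A w c t = t" by auto
  have "score el A w c = t"
    unfolding score_def
  proof (rule Greatest_equality)
    fix s assume s: "0 \<le> s \<and> s \<le> prescore el A w c s"
    show "s \<le> t"
    proof (rule ccontr)
      assume "\<not> s \<le> t"
      then show False using prescore_antimono[OF w, of t s A c] s t by simp
    qed
  qed (use t in simp)
  then show "prescore el A w c (score el A w c) = score el A w c" "0 \<le> score el A w c"
    using t by simp_all
qed

text \<open>Reduces a comparison with a score to the prescore at a single threshold.\<close>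

lemma score_le_iff:
  assumes "feasible el w"
  shows "score el A w c \<le> t \<longleftrightarrow> prescore el A w c t \<le> t"
  using prescore_antimono[OF assms, of "score el A w c" t A c]
    prescore_antimono[OF assms, of t "score el A w c" A c] score_fixpoint[OF assms, of A c]
  by linarith

section \<open>Support of a full committee and the score condition\<close>

lemma full_nonempty: "full el A \<Longrightarrow> A \<noteq> {}"
  using csize_pos by (auto simp: full_def)

lemma full_subset: "full el A \<Longrightarrow> A \<subseteq> cands el"
  by (simp add: full_def)

lemma full_finite: "full el A \<Longrightarrow> finite A"
  using full_subset finite_committee by blast

lemma min_supp_le: "full el A \<Longrightarrow> c \<in> A \<Longrightarrow> min_supp el w A \<le> supp el w c"
  using full_finite by (simp add: min_supp_def)

lemma min_supp_in: "full el A \<Longrightarrow> min_supp el w A \<in> supp el w ` A"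
  unfolding min_supp_def using full_finite full_nonempty by (intro Min_in) auto

lemma min_supp_nonneg: "full el A \<Longrightarrow> feasible el w \<Longrightarrow> 0 \<le> min_supp el w A"
  using min_supp_in[of A w] supp_nonneg by auto

text \<open>\<open>Min\<close> and \<open>Max\<close> both range over finite non-empty sets; for
  \<open>Max\<close> this holds because the committee size is below the number of
  candidates.\<close>

lemma score_condition_iff_score:
  assumes A: "full el A"
  shows "score_condition el A w \<longleftrightarrow> (\<forall>c\<in>cands el - A. \<forall>d\<in>A. score el A w c \<le> supp el w d)"
proof -
  have "card A < card (cands el)" using A csize_less by (simp add: full_def)
  then have "cands el - A \<noteq> {}"
    using card_mono[OF full_finite[OF A], of "cands el"] by auto
  then show ?thesis
    using finite_cands full_finite[OF A] full_nonempty[OF A]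
    by (auto simp: score_condition_def min_supp_def)
qed

lemma score_condition_iff_prescore:
  assumes A: "full el A" and w: "feasible el w"
  shows "score_condition el A w \<longleftrightarrow>
    (\<forall>c\<in>cands el - A. prescore el A w c (min_supp el w A) \<le> min_supp el w A)"
  using full_finite[OF A] full_nonempty[OF A]
  by (simp add: score_condition_iff_score[OF A] score_le_iff[OF w, symmetric] min_supp_def)


section \<open>Proportional justified representation\<close>

text \<open>At the threshold \<open>T\<close> each member of \<open>A\<close> absorbs exactly
  \<open>T\<close>, and a violating group approves fewer than \<open>r\<close> members. The group
  thus keeps so much slack that a commonly approved unelected candidate gets a prescore of at least
  \<open>S / k\<close>.\<close>

lemma score_condition_PJR:
  assumes A: "full el A" and w: "feasible el w" and sc: "score_condition el A w"
  shows "PJR el A"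
  unfolding PJR_def
proof (intro notI, elim exE conjE)
  fix N' r
  assume N': "N' \<subseteq> voters el" and r: "0 < r" "r \<le> csize el"
    and large: "(\<Sum>n\<in>N'. strength el n) \<ge> real r / real (csize el) * (\<Sum>n\<in>voters el. strength el n)"
    and common: "card (cands el \<inter> (\<Inter>n\<in>N'. approved el n)) \<ge> r"
    and few: "card (A \<inter> (\<Union>n\<in>N'. approved el n)) < r"
  define S where "S = (\<Sum>n\<in>voters el. strength el n)"
  define k where "k = real (csize el)"
  define T where "T = min_supp el w A"
  define U where "U = (\<Union>n\<in>N'. approved el n)"
  \<comment> \<open>The weight that remains on an edge when every support is scaled down to
    \<open>T\<close>.\<close>
  define h where "h n c = w (n, c) * min 1 (T / supp el w c)" for n c
  note S = total_strength_pos[folded S_def]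
  have k: "0 < k" using csize_pos by (simp add: k_def)
  have T: "0 \<le> T" "\<And>c. c \<in> A \<Longrightarrow> T \<le> supp el w c"
    using min_supp_nonneg[OF A w] min_supp_le[OF A] by (auto simp: T_def)
  have h_nonneg: "0 \<le> h n c" if "c \<in> approved el n" for n c
    using feasible_nonneg'[OF w that] T supp_nonneg[OF w] by (simp add: h_def)
  have h_sum: "(\<Sum>n\<in>approvers el c. h n c) = T" if "c \<in> A" for c
  proof -
    have "(\<Sum>n\<in>approvers el c. h n c) = supp el w c * min 1 (T / supp el w c)"
      by (simp add: h_def supp_def sum_distrib_right)
    also have "\<dots> = T" using T(1) T(2)[OF that] by (cases "supp el w c = 0") (auto simp: min_def)
    finally show ?thesis .
  qed
  have swap: "(\<Sum>n\<in>voters el. \<Sum>c\<in>B \<inter> approved el n. h n c) = card B * T" if "B \<subseteq> A" for B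
    using sum_cands_voters_swap[of B h] that full_subset[OF A] h_sum by (simp add: subset_iff)
  have total_slack: "(\<Sum>n\<in>voters el. slack el A w n T) = S - k * T"
    using swap[of A] A by (simp add: slack_def sum_subtractf S_def h_def k_def full_def)
  have "0 \<le> (\<Sum>n\<in>voters el. slack el A w n T)"
    by (intro sum_nonneg slack_nonneg[OF w])
  then have kT: "k * T \<le> S" using total_slack by simp
  have "0 < (\<Sum>n\<in>N'. strength el n)"
    using large r S k by (auto simp: S_def k_def intro!: less_le_trans[OF _ large] mult_pos_pos divide_pos_pos)
  \<comment> \<open>An empty group would have the whole type as intersection of its approval sets,
    and \<open>U\<close> would be empty.\<close>
  then have "N' \<noteq> {}" by auto
  then have "cands el \<inter> (\<Inter>n\<in>N'. approved el n) \<subseteq> U" by (auto simp: U_def)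
  moreover have "\<not> cands el \<inter> (\<Inter>n\<in>N'. approved el n) \<subseteq> A \<inter> U"
  proof
    assume "cands el \<inter> (\<Inter>n\<in>N'. approved el n) \<subseteq> A \<inter> U"
    then have "card (cands el \<inter> (\<Inter>n\<in>N'. approved el n)) \<le> card (A \<inter> U)"
      using full_finite[OF A] by (intro card_mono) auto
    then show False using common few by (simp add: U_def)
  qed
  ultimately obtain c where c: "c \<in> cands el - A" "\<And>n. n \<in> N' \<Longrightarrow> c \<in> approved el n" by blast
  have le_T: "prescore el A w c T \<le> T"
    using sc c by (auto simp: score_condition_iff_prescore[OF A w] T_def)
  have "(\<Sum>n\<in>N'. \<Sum>c\<in>A \<inter> approved el n. h n c) = (\<Sum>n\<in>N'. \<Sum>c\<in>(A \<inter> U) \<inter> approved el n. h n c)"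
    by (intro sum.cong) (auto simp: U_def)
  also have "\<dots> \<le> (\<Sum>n\<in>voters el. \<Sum>c\<in>(A \<inter> U) \<inter> approved el n. h n c)"
    using N' finite_voters by (intro sum_mono2 sum_nonneg h_nonneg) auto
  also have "\<dots> = card (A \<inter> U) * T" by (rule swap) simp
  also have "\<dots> \<le> (real r - 1) * T"
    using few T(1) by (intro mult_right_mono) (auto simp: U_def)
  finally have "real r / k * S - (real r - 1) * T \<le> (\<Sum>n\<in>N'. slack el A w n T)"
    using large by (simp add: slack_def sum_subtractf h_def S_def k_def)
  also have "\<dots> \<le> prescore el A w c T"
    unfolding prescore_def using c
    by (intro sum_mono2) (auto simp: approved_iff_approvers intro: slack_nonneg[OF w] in_approvers_voter)
  finally have low: "real r / k * S - (real r - 1) * T \<le> prescore el A w c T" .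
  have "real r / k * S - (real r - 1) * T = S / k + (real r - 1) * (S / k - T)"
    using k by (simp add: field_simps)
  moreover have "T \<le> S / k" using kT k by (simp add: field_simps)
  moreover have "0 \<le> (real r - 1) * (S / k - T)" using r \<open>T \<le> S / k\<close> by simp
  \<comment> \<open>The chain \<open>S / k\<close> \<le> prescore \<le> \<open>T\<close> \<le>
    \<open>S / k\<close> collapses, so only the equality case is left. There the total slack is
    zero, against a positive prescore.\<close>
  ultimately have pre: "S / k \<le> prescore el A w c T" and eq: "T = S / k"
    using low le_T by linarith+
  have "prescore el A w c T \<le> (\<Sum>n\<in>voters el. slack el A w n T)"
    unfolding prescore_def using approvers_subset finite_voters
    by (intro sum_mono2) (auto intro: slack_nonneg[OF w])
  also have "\<dots> = 0" using total_slack eq k by simp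
  finally show False using pre divide_pos_pos[OF S k] by linarith
qed


section \<open>Comparing balanced weights with other solutions\<close>

text \<open>Balanced weights also maximize the least support. Let \<open>D\<close> be the members
  with support below \<open>x\<close>. Every voter who approves one of them spends her full strength
  inside \<open>D\<close>, so no feasible vector can give \<open>D\<close> a larger total.\<close>

lemma balanced_supp_ge:
  assumes A: "A \<subseteq> cands el" and bal: "balanced el A w" and v: "feasible el v"
    and ge: "\<And>d. d \<in> A \<Longrightarrow> x \<le> supp el v d" and d: "d \<in> A"
  shows "x \<le> supp el w d"
proof (rule ccontr)
  assume "\<not> x \<le> supp el w d"
  define D where "D = {c \<in> A. supp el w c < x}"
  have D: "D \<subseteq> A" "D \<subseteq> cands el" "finite D" "d \<in> D"
    using A d \<open>\<not> x \<le> supp el w d\<close> finite_committee[OF A] by (auto simp: D_def)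
  have exh: "exhaustive A w" and conc: "concentrated A w" and w: "feasible el w"
    using bal by (auto simp: balanced_iff[OF A] exhaustive_def)
  have "(\<Sum>c\<in>D \<inter> approved el n. v (n, c)) \<le> (\<Sum>c\<in>D \<inter> approved el n. w (n, c))"
    if n: "n \<in> voters el" for n
  proof (cases "D \<inter> approved el n = {}")
    case False
    then obtain b where b: "b \<in> D" "b \<in> approved el n" by blast
    have "(\<Sum>c\<in>D \<inter> approved el n. w (n, c)) = (\<Sum>c\<in>A \<inter> approved el n. w (n, c))"
    proof (rule sum.mono_neutral_left)
      show "\<forall>c\<in>A \<inter> approved el n - D \<inter> approved el n. w (n, c) = 0"
      proof
        fix c assume c: "c \<in> A \<inter> approved el n - D \<inter> approved el n"
        then have "\<not> supp el w c \<le> supp el w b" using b by (auto simp: D_def)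
        then have "\<not> 0 < w (n, c)" using conc b c D by (auto simp: concentrated_def)
        then show "w (n, c) = 0" using feasible_nonneg'[OF w, of c n] c by auto
      qed
    qed (use D in auto)
    also have "\<dots> = strength el n" using exh n b D by (auto simp: exhaustive_def)
    finally show ?thesis using feasible_sum_le[OF v n, of "D \<inter> approved el n"] by simp
  qed (simp only: sum.empty)
  then have "(\<Sum>c\<in>D. supp el v c) \<le> (\<Sum>c\<in>D. supp el w c)"
    unfolding total_supp[OF D(2)] by (rule sum_mono)
  moreover have "(\<Sum>c\<in>D. supp el w c) < (\<Sum>c\<in>D. supp el v c)"
    using D ge by (intro sum_strict_mono) (force simp: D_def)+
  ultimately show False by simp
qed

text \<open>Let \<open>D\<close> be the members whose support rises. Some voter gives
  \<open>D\<close> more under \<open>v\<close> than under \<open>w\<close>, so under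
  \<open>w\<close> she also funds a member \<open>b\<close> of \<open>A\<close> outside
  \<open>D\<close>. Concentration of both vectors at this voter makes the supports of
  \<open>b\<close> and of a member \<open>c\<close> of \<open>D\<close> contradict each
  other.\<close>

lemma balanced_supp_antimono:
  assumes AB: "A \<subseteq> B" and B: "B \<subseteq> cands el"
    and w: "balanced el A w" and v: "balanced el B v" and d: "d \<in> A"
  shows "supp el v d \<le> supp el w d"
proof (rule ccontr)
  assume "\<not> supp el v d \<le> supp el w d"
  have A: "A \<subseteq> cands el" using AB B by blast
  have exh: "exhaustive A w" and concw: "concentrated A w" and fw: "feasible el w"
    using w by (auto simp: balanced_iff[OF A] exhaustive_def)
  have concv: "concentrated B v" and fv: "feasible el v"
    using v by (auto simp: balanced_iff[OF B] exhaustive_def)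
  define D where "D = {c \<in> A. supp el w c < supp el v c}"
  have D: "D \<subseteq> A" "D \<subseteq> cands el" "finite D" "d \<in> D"
    using A d \<open>\<not> supp el v d \<le> supp el w d\<close> finite_committee[OF A] by (auto simp: D_def)
  have "(\<Sum>c\<in>D. supp el w c) < (\<Sum>c\<in>D. supp el v c)"
    using D by (intro sum_strict_mono) (auto simp: D_def)
  then obtain n where n: "n \<in> voters el"
    and less: "(\<Sum>c\<in>D \<inter> approved el n. w (n, c)) < (\<Sum>c\<in>D \<inter> approved el n. v (n, c))"
    unfolding total_supp[OF D(2)] by (meson not_less sum_mono)
  have "0 \<le> (\<Sum>c\<in>D \<inter> approved el n. w (n, c))"
    by (intro sum_nonneg feasible_nonneg'[OF fw]) simp
  then have "\<not> (\<Sum>c\<in>D \<inter> approved el n. v (n, c)) \<le> 0" using less by simp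
  then obtain c where c: "c \<in> D" "c \<in> approved el n" "0 < v (n, c)"
    by (metis IntE not_less sum_nonpos)
  have "(\<Sum>c\<in>A \<inter> approved el n. w (n, c)) = strength el n"
    using exh n c D by (auto simp: exhaustive_def)
  moreover have "(\<Sum>c\<in>D \<inter> approved el n. v (n, c)) \<le> strength el n"
    by (intro feasible_sum_le[OF fv n]) simp
  moreover have "A \<inter> approved el n = (D \<inter> approved el n) \<union> ((A - D) \<inter> approved el n)" using D by auto
  then have "(\<Sum>c\<in>A \<inter> approved el n. w (n, c)) =
      (\<Sum>c\<in>D \<inter> approved el n. w (n, c)) + (\<Sum>c\<in>(A - D) \<inter> approved el n. w (n, c))"
    by (simp add: sum.union_disjoint Int_Un_distrib disjoint_iff)
  ultimately have "\<not> (\<Sum>c\<in>(A - D) \<inter> approved el n. w (n, c)) \<le> 0" using less by simp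
  then obtain b where b: "b \<in> A - D" "b \<in> approved el n" "0 < w (n, b)"
    by (metis IntE not_less sum_nonpos)
  have "supp el v c \<le> supp el v b"
    using concv c b D AB unfolding concentrated_def by blast
  also have "\<dots> \<le> supp el w b" using b by (auto simp: D_def)
  also have "\<dots> \<le> supp el w c" using concw c b D by (auto simp: concentrated_def)
  also have "\<dots> < supp el v c" using c by (simp add: D_def)
  finally show False by simp
qed

text \<open>All positive weights of the voter lie on members with the same least support, so one
  common factor scales her whole strength.\<close>

lemma slack_concentrated:
  assumes exh: "exhaustive A w" and conc: "concentrated A w" and n: "n \<in> voters el"
    and d: "d \<in> A \<inter> approved el n" and least: "\<And>c. c \<in> A \<inter> approved el n \<Longrightarrow> supp el w d \<le> supp el w c"
  shows "slack el A w n t = strength el n * (1 - min 1 (t / supp el w d))"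
proof -
  have w: "feasible el w" using exh by (simp add: exhaustive_def)
  have "w (n, c) * min 1 (t / supp el w c) = w (n, c) * min 1 (t / supp el w d)"
    if c: "c \<in> A \<inter> approved el n" for c
  proof (cases "0 < w (n, c)")
    case True
    then have "supp el w c = supp el w d"
      using conc c d least[OF c] by (auto simp: concentrated_def intro: antisym)
    then show ?thesis by simp
  next
    case False
    then show ?thesis using feasible_nonneg'[OF w, of c n] c by auto
  qed
  then have "(\<Sum>c\<in>A \<inter> approved el n. w (n, c) * min 1 (t / supp el w c)) =
      (\<Sum>c\<in>A \<inter> approved el n. w (n, c) * min 1 (t / supp el w d))" by (rule sum.cong[OF refl])
  also have "\<dots> = strength el n * min 1 (t / supp el w d)"
    using exh n d by (auto simp: exhaustive_def sum_distrib_right[symmetric])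
  finally show ?thesis by (simp add: slack_def algebra_simps)
qed

lemma least_supp_exists:
  assumes "A \<inter> approved el n \<noteq> {}"
  obtains d where "d \<in> A \<inter> approved el n" "\<And>c. c \<in> A \<inter> approved el n \<Longrightarrow> supp el w d \<le> supp el w c"
proof -
  have "Min (supp el w ` (A \<inter> approved el n)) \<in> supp el w ` (A \<inter> approved el n)"
    using assms by (intro Min_in) auto
  then obtain d where "d \<in> A \<inter> approved el n" "supp el w d = Min (supp el w ` (A \<inter> approved el n))"
    by auto
  then show ?thesis by (intro that[of d]) simp_all
qed

text \<open>The least support among the members a voter approves can only go down: there are more
  members, and each old one has at most its old support.\<close>

lemma balanced_slack_antimono:
  assumes AB: "A \<subseteq> B" and B: "B \<subseteq> cands el"
    and w: "balanced el A w" and v: "balanced el B v" and n: "n \<in> voters el" and t: "0 \<le> t"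
  shows "slack el B v n t \<le> slack el A w n t"
proof -
  have A: "A \<subseteq> cands el" using AB B by blast
  have exhw: "exhaustive A w" and concw: "concentrated A w" and fw: "feasible el w"
    using w by (auto simp: balanced_iff[OF A] exhaustive_def)
  have exhv: "exhaustive B v" and concv: "concentrated B v" and fv: "feasible el v"
    using v by (auto simp: balanced_iff[OF B] exhaustive_def)
  show ?thesis
  proof (cases "A \<inter> approved el n = {}")
    case True
    have "0 \<le> (\<Sum>c\<in>B \<inter> approved el n. v (n, c) * min 1 (t / supp el v c))"
      using t by (intro sum_nonneg mult_nonneg_nonneg) (auto intro: feasible_nonneg'[OF fv] divide_nonneg_nonneg supp_nonneg[OF fv])
    then show ?thesis using True by (simp add: slack_def)
  next
    case False
    then obtain d where d: "d \<in> A \<inter> approved el n" "\<And>c. c \<in> A \<inter> approved el n \<Longrightarrow> supp el w d \<le> supp el w c"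
      using least_supp_exists by blast
    have "B \<inter> approved el n \<noteq> {}" using False AB by blast
    then obtain b where b: "b \<in> B \<inter> approved el n" "\<And>c. c \<in> B \<inter> approved el n \<Longrightarrow> supp el v b \<le> supp el v c"
      using least_supp_exists by blast
    have "supp el v b \<le> supp el v d" using b d AB by auto
    also have "\<dots> \<le> supp el w d" using balanced_supp_antimono[OF AB B w v] d by auto
    finally have le: "supp el v b \<le> supp el w d" .
    show ?thesis
    \<comment> \<open>A voter of positive strength gives weight to some member, so the least support
      she sees is positive. For a zero support the convention \<open>t / 0 = 0\<close> would break
      the comparison of the quotients.\<close>
    proof (cases "strength el n = 0")
      case True
      then show ?thesis
        using slack_concentrated[OF exhw concw n d] slack_concentrated[OF exhv concv n b] by simp
    next
      case False
      then have "0 < (\<Sum>c\<in>B \<inter> approved el n. v (n, c))"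
        using exhv n b strength_nonneg[OF n] by (auto simp: exhaustive_def)
      then obtain c where c: "c \<in> B \<inter> approved el n" "0 < v (n, c)"
        by (meson not_less sum_nonpos)
      have "0 < supp el v c" using weight_le_supp[OF fv, of n c] c by (simp add: approved_iff_approvers)
      also have "supp el v c \<le> supp el v b" using concv c b by (auto simp: concentrated_def)
      finally have "t / supp el w d \<le> t / supp el v b" using le t by (intro divide_left_mono mult_pos_pos) auto
      then show ?thesis
        using slack_concentrated[OF exhw concw n d] slack_concentrated[OF exhv concv n b] strength_nonneg[OF n]
        by (auto intro!: mult_left_mono)
    qed
  qed
qed

text \<open>The prescore drops at every non-negative threshold, hence so does its fixed
  point.\<close>

lemma balanced_score_antimono:
  assumes AB: "A \<subseteq> B" and B: "B \<subseteq> cands el" and w: "balanced el A w" and v: "balanced el B v"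
  shows "score el B v c \<le> score el A w c"
proof -
  have A: "A \<subseteq> cands el" using AB B by blast
  have fw: "feasible el w" and fv: "feasible el v"
    using w v by (auto simp: balanced_iff[OF A] balanced_iff[OF B] exhaustive_def)
  have "prescore el B v c (score el A w c) \<le> prescore el A w c (score el A w c)"
    unfolding prescore_def
    by (intro sum_mono balanced_slack_antimono[OF AB B w v] in_approvers_voter score_fixpoint(2)[OF fw])
  then show ?thesis by (simp add: score_le_iff[OF fv] score_fixpoint(1)[OF fw])
qed


section \<open>The approximation guarantee\<close>

text \<open>An averaging argument: if all prescores over \<open>B - A\<close> were below
  \<open>t\<close>, their sum would be below \<open>t * m\<close>, while a lower bound charged to
  the weights of \<open>v\<close> shows that it is at least \<open>t * m\<close>.\<close>

lemma balanced_prescore_large: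
  assumes A: "full el A" and bal: "balanced el A w" and B: "full el B" and v: "feasible el v"
    and neq: "A \<noteq> B" and t: "0 < t" "3 * t \<le> min_supp el v B"
  shows "\<exists>c\<in>B - A. t \<le> prescore el A w c t"
proof (rule ccontr)
  assume "\<not> (\<exists>c\<in>B - A. t \<le> prescore el A w c t)"
  then have small: "\<And>c. c \<in> B - A \<Longrightarrow> prescore el A w c t < t" by force
  note AC = full_subset[OF A] and BC = full_subset[OF B]
  have exh: "exhaustive A w" and conc: "concentrated A w" and w: "feasible el w"
    using bal by (auto simp: balanced_iff[OF AC] exhaustive_def)
  define m where "m = real (card (B - A))"
  have cards: "card (A - B) = card (B - A)"
    using A B full_finite by (intro card_le_sym_Diff antisym) (auto simp: full_def)
  have "B - A \<noteq> {}"
  proof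
    assume "B - A = {}"
    then have "card (A - B) = 0" using cards by (simp only: card.empty)
    then show False using neq \<open>B - A = {}\<close> full_finite[OF A] by auto
  qed
  \<comment> \<open>The scaling factor at threshold \<open>t\<close>. Unlike
    \<open>min 1 (t / supp el w c)\<close> it is 1 at support zero, which makes it antitone in the
    support.\<close>
  define q where "q c = t / max t (supp el w c)" for c
  have q: "0 \<le> q c" "q c \<le> 1" for c using t by (auto simp: q_def)
  have q_antimono: "q c \<le> q d" if "supp el w d \<le> supp el w c" for c d
    unfolding q_def using that t by (intro divide_left_mono mult_pos_pos) auto
  have supp_q: "supp el w c * q c \<le> t" for c
    using t supp_nonneg[OF w, of c] by (auto simp: q_def max_def field_simps)
  \<comment> \<open>The fraction of her strength that voter \<open>n\<close> still spends on
    \<open>A\<close> after the scaling, governed by the least supported member she approves. It is 0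
    if she approves no member and spends nothing.\<close>
  define \<psi> where "\<psi> n = (if A \<inter> approved el n = {} then 0 else Max (q ` (A \<inter> approved el n)))" for n
  have \<psi>_ge: "q c \<le> \<psi> n" if "c \<in> A \<inter> approved el n" for c n
    using that by (auto simp: \<psi>_def)
  have \<psi>_le: "\<psi> n \<le> x" if "0 \<le> x" "\<And>c. c \<in> A \<inter> approved el n \<Longrightarrow> q c \<le> x" for n x
    using that by (auto simp: \<psi>_def)
  have \<psi>: "0 \<le> \<psi> n" "\<psi> n \<le> 1" for n
  proof -
    show "\<psi> n \<le> 1" by (intro \<psi>_le q) simp
    show "0 \<le> \<psi> n"
    proof (cases "A \<inter> approved el n = {}")
      case False
      then obtain c where "c \<in> A \<inter> approved el n" by blast
      then show ?thesis using \<psi>_ge q(1)[of c] by force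
    qed (simp add: \<psi>_def)
  qed
  have \<psi>_eq: "\<psi> n = q c" if "c \<in> A \<inter> approved el n" "0 < w (n, c)" for c n
    using that conc by (intro antisym \<psi>_ge \<psi>_le q q_antimono) (auto simp: concentrated_def)
  have w0: "w (n, c) = 0" if "c \<in> A \<inter> approved el n" "\<not> 0 < w (n, c)" for n c
    using feasible_nonneg'[OF w, of c n] that by auto
  have spent: "strength el n * \<psi> n = (\<Sum>c\<in>A \<inter> approved el n. w (n, c) * q c)" if n: "n \<in> voters el" for n
  proof (cases "A \<inter> approved el n = {}")
    case True
    then show ?thesis unfolding True by (simp add: \<psi>_def True)
  next
    case False
    then have "strength el n * \<psi> n = (\<Sum>c\<in>A \<inter> approved el n. w (n, c) * \<psi> n)"
      using exh n by (simp add: exhaustive_def sum_distrib_right[symmetric])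
    also have "\<dots> = (\<Sum>c\<in>A \<inter> approved el n. w (n, c) * q c)"
      by (intro sum.cong refl) (metis \<psi>_eq w0 mult_zero_left)
    finally show ?thesis .
  qed
  have slack: "slack el A w n t = strength el n * (1 - \<psi> n)" if n: "n \<in> voters el" for n
  proof -
    have "w (n, c) * min 1 (t / supp el w c) = w (n, c) * q c" if c: "c \<in> A \<inter> approved el n" for c
    proof (cases "0 < w (n, c)")
      case True
      then have "0 < supp el w c"
        using weight_le_supp[OF w, of n c] c by (simp add: approved_iff_approvers)
      then show ?thesis using t by (auto simp: q_def min_def max_def field_simps)
    qed (use w0[OF c] in simp)
    then have "slack el A w n t = strength el n - (\<Sum>c\<in>A \<inter> approved el n. w (n, c) * q c)"
      unfolding slack_def by (intro arg_cong2[of _ _ _ _ minus] sum.cong refl)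
    then show ?thesis using spent[OF n] by (simp add: algebra_simps)
  qed
  define \<tau> where "\<tau> = min_supp el v B"
  have \<tau>: "3 * t \<le> \<tau>" "\<And>c. c \<in> B \<Longrightarrow> \<tau> \<le> supp el v c"
    using t min_supp_le[OF B] by (auto simp: \<tau>_def)
  \<comment> \<open>Voters in \<open>Low\<close> approve a member of support at most \<tau>, so
    concentration confines their positive weights within \<open>A\<close> to
    \<open>L\<close>.\<close>
  define L where "L = {c \<in> A. supp el w c \<le> \<tau>}"
  define Low where "Low = {n \<in> voters el. L \<inter> approved el n \<noteq> {}}"
  have LC: "L \<subseteq> cands el" "finite L" using AC full_finite[OF A] by (auto simp: L_def)
  \<comment> \<open>What \<open>v\<close> lets the voter spend on the candidates of \<open>B\<close>
    outside \<open>A\<close>; \<open>g\<close> is what it lets her spend on the common ones.\<close>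
  define f where "f n = (\<Sum>c\<in>(B - A) \<inter> approved el n. v (n, c))" for n
  define g where "g n = (\<Sum>c\<in>(B \<inter> A) \<inter> approved el n. v (n, c))" for n
  have f_nonneg: "0 \<le> f n" for n
    unfolding f_def by (intro sum_nonneg feasible_nonneg'[OF v]) simp
  have fg: "f n + g n \<le> strength el n" if n: "n \<in> voters el" for n
  proof -
    have "f n + g n = (\<Sum>c\<in>((B - A) \<inter> approved el n) \<union> ((B \<inter> A) \<inter> approved el n). v (n, c))"
      unfolding f_def g_def by (intro sum.union_disjoint[symmetric]) auto
    also have "\<dots> \<le> strength el n" by (intro feasible_sum_le[OF v n]) auto
    finally show ?thesis .
  qed
  have "(\<Sum>n\<in>Low. strength el n * \<psi> n) \<le> (\<Sum>c\<in>L. supp el w c * q c)"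
  proof -
    have "strength el n * \<psi> n = (\<Sum>c\<in>L \<inter> approved el n. w (n, c) * q c)" if n: "n \<in> Low" for n
    proof -
      obtain b where b: "b \<in> L" "b \<in> approved el n" using n by (auto simp: Low_def)
      have "w (n, c) = 0" if c: "c \<in> A \<inter> approved el n - L \<inter> approved el n" for c
      proof -
        have "\<not> supp el w c \<le> supp el w b" using b c by (auto simp: L_def)
        then have "\<not> 0 < w (n, c)" using conc b c by (auto simp: concentrated_def L_def)
        then show ?thesis using w0 c by auto
      qed
      then have "(\<Sum>c\<in>L \<inter> approved el n. w (n, c) * q c) = (\<Sum>c\<in>A \<inter> approved el n. w (n, c) * q c)"
        by (intro sum.mono_neutral_left) (auto simp: L_def)
      then show ?thesis using spent n by (simp add: Low_def)
    qed
    then have "(\<Sum>n\<in>Low. strength el n * \<psi> n) = (\<Sum>n\<in>Low. \<Sum>c\<in>L \<inter> approved el n. w (n, c) * q c)"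
      by (rule sum.cong[OF refl])
    also have "\<dots> = (\<Sum>n\<in>voters el. \<Sum>c\<in>L \<inter> approved el n. w (n, c) * q c)"
      using finite_voters by (intro sum.mono_neutral_left) (auto simp: Low_def)
    also have "\<dots> = (\<Sum>c\<in>L. supp el w c * q c)"
      using sum_cands_voters_swap[OF LC(1), of "\<lambda>n c. w (n, c) * q c"]
      by (simp add: supp_def sum_distrib_right)
    finally show ?thesis by simp
  qed
  \<comment> \<open>A candidate of \<open>L\<close> that lies in \<open>B\<close> has at least as
    much support under \<open>v\<close> as under \<open>w\<close>, with \<tau> in between, and only
    voters of \<open>Low\<close> contribute to it.\<close>
  moreover have "(\<Sum>c\<in>L \<inter> B. supp el w c * q c) \<le> (\<Sum>n\<in>Low. g n * \<psi> n)"
  proof -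
    have "(\<Sum>c\<in>L \<inter> B. supp el w c * q c) \<le> (\<Sum>c\<in>L \<inter> B. supp el v c * q c)"
      using \<tau> by (intro sum_mono mult_right_mono q) (force simp: L_def)
    also have "\<dots> = (\<Sum>n\<in>voters el. \<Sum>c\<in>(L \<inter> B) \<inter> approved el n. v (n, c) * q c)"
      using sum_cands_voters_swap[of "L \<inter> B" "\<lambda>n c. v (n, c) * q c"] LC
      by (simp add: supp_def sum_distrib_right le_infI1)
    also have "\<dots> = (\<Sum>n\<in>Low. \<Sum>c\<in>(L \<inter> B) \<inter> approved el n. v (n, c) * q c)"
      using finite_voters by (intro sum.mono_neutral_right) (auto simp: Low_def intro!: sum.neutral)
    also have "\<dots> \<le> (\<Sum>n\<in>Low. g n * \<psi> n)"
    proof (rule sum_mono)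
      fix n assume "n \<in> Low"
      have "(\<Sum>c\<in>(L \<inter> B) \<inter> approved el n. v (n, c) * q c) \<le> (\<Sum>c\<in>(L \<inter> B) \<inter> approved el n. v (n, c) * \<psi> n)"
        by (intro sum_mono mult_left_mono \<psi>_ge feasible_nonneg'[OF v]) (auto simp: L_def)
      also have "\<dots> \<le> (\<Sum>c\<in>(B \<inter> A) \<inter> approved el n. v (n, c) * \<psi> n)"
        by (intro sum_mono2) (auto simp: L_def intro!: mult_nonneg_nonneg \<psi> feasible_nonneg'[OF v])
      finally show "(\<Sum>c\<in>(L \<inter> B) \<inter> approved el n. v (n, c) * q c) \<le> g n * \<psi> n"
        by (simp add: g_def sum_distrib_right)
    qed
    finally show ?thesis .
  qed
  \<comment> \<open>The two parts \<open>f\<close> and \<open>g\<close> share one budget, so what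
    \<open>v\<close> spends on common candidates reduces the loss charged to the new ones.\<close>
  moreover have "(\<Sum>n\<in>Low. f n * \<psi> n) \<le> (\<Sum>n\<in>Low. strength el n * \<psi> n) - (\<Sum>n\<in>Low. g n * \<psi> n)"
    unfolding sum_subtractf[symmetric] left_diff_distrib[symmetric]
    using fg by (intro sum_mono mult_right_mono \<psi>) (force simp: Low_def)
  moreover have "(\<Sum>c\<in>L. supp el w c * q c) = (\<Sum>c\<in>L \<inter> B. supp el w c * q c) + (\<Sum>c\<in>L - B. supp el w c * q c)"
    using LC by (intro sum.Int_Diff)
  moreover have "(\<Sum>c\<in>L - B. supp el w c * q c) \<le> t * m"
  proof -
    have "(\<Sum>c\<in>L - B. supp el w c * q c) \<le> card (L - B) * t"
      using supp_q by (intro sum_bounded_above)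
    also have "\<dots> \<le> card (A - B) * t"
      using t full_finite[OF A] by (intro mult_right_mono of_nat_mono card_mono) (auto simp: L_def)
    finally show ?thesis using cards by (simp add: m_def mult.commute)
  qed
  ultimately have low: "(\<Sum>n\<in>Low. f n * \<psi> n) \<le> t * m" by linarith
  have "(\<Sum>n\<in>voters el - Low. f n * \<psi> n) \<le> (\<Sum>n\<in>voters el - Low. f n / 3)"
  proof (rule sum_mono)
    fix n assume n: "n \<in> voters el - Low"
    \<comment> \<open>Voters outside \<open>Low\<close> see only supports above \<tau>, hence above
      \<open>3 * t\<close>.\<close>
    have "q c \<le> 1 / 3" if c: "c \<in> A \<inter> approved el n" for c
    proof -
      have "\<tau> < supp el w c" using n c by (auto simp: Low_def L_def)
      then show ?thesis using t \<tau>(1) by (auto simp: q_def max_def field_simps)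
    qed
    then have "\<psi> n \<le> 1 / 3" by (intro \<psi>_le) auto
    then show "f n * \<psi> n \<le> f n / 3" using f_nonneg[of n] mult_left_mono[of "\<psi> n" "1 / 3" "f n"] by simp
  qed
  also have "\<dots> \<le> (\<Sum>n\<in>voters el. f n / 3)"
    using finite_voters f_nonneg by (intro sum_mono2) auto
  finally have high: "(\<Sum>n\<in>voters el - Low. f n * \<psi> n) \<le> (\<Sum>n\<in>voters el. f n) / 3"
    by (simp add: sum_divide_distrib)
  have "(\<Sum>n\<in>voters el. f n) = (\<Sum>c\<in>B - A. supp el v c)"
    unfolding f_def using BC by (intro total_supp[symmetric]) auto
  also have "\<dots> \<ge> m * \<tau>"
    unfolding m_def using \<tau> by (intro sum_bounded_below) auto
  finally have "m * (3 * t) \<le> (\<Sum>n\<in>voters el. f n)"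
    using mult_left_mono[OF \<tau>(1), of m] by (simp add: m_def)
  then have f_total: "3 * (t * m) \<le> (\<Sum>n\<in>voters el. f n)" by (simp add: algebra_simps)
  have "(\<Sum>n\<in>voters el. f n * \<psi> n) = (\<Sum>n\<in>voters el - Low. f n * \<psi> n) + (\<Sum>n\<in>Low. f n * \<psi> n)"
    using finite_voters by (intro sum.subset_diff) (auto simp: Low_def)
  \<comment> \<open>The new candidates carry at least \<open>3 * t * m\<close> under
    \<open>v\<close>. At most \<open>t * m\<close> is lost on \<open>Low\<close> and at most a third
    of the whole elsewhere, which leaves \<open>t * m\<close>; this balance determines the factor
    3.\<close>
  then have "t * m \<le> (\<Sum>n\<in>voters el. f n) - (\<Sum>n\<in>voters el. f n * \<psi> n)"
    using low high f_total by linarith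
  also have "\<dots> = (\<Sum>n\<in>voters el. \<Sum>c\<in>(B - A) \<inter> approved el n. v (n, c) * (1 - \<psi> n))"
    by (simp add: f_def sum_distrib_right right_diff_distrib sum_subtractf)
  also have "\<dots> = (\<Sum>c\<in>B - A. \<Sum>n\<in>approvers el c. v (n, c) * (1 - \<psi> n))"
    using BC by (intro sum_cands_voters_swap[symmetric]) auto
  \<comment> \<open>The prescore counts the full slack of each approver, and \<open>v\<close> gives
    the candidate at most her full strength.\<close>
  also have "\<dots> \<le> (\<Sum>c\<in>B - A. prescore el A w c t)"
  proof (rule sum_mono)
    fix c
    show "(\<Sum>n\<in>approvers el c. v (n, c) * (1 - \<psi> n)) \<le> prescore el A w c t"
      unfolding prescore_def
    proof (rule sum_mono)
      fix n assume n: "n \<in> approvers el c"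
      then have "v (n, c) \<le> strength el n"
        by (intro feasible_le_strength[OF v]) (simp add: approved_iff_approvers)
      then show "v (n, c) * (1 - \<psi> n) \<le> slack el A w n t"
        unfolding slack[OF in_approvers_voter[OF n]] using \<psi> by (intro mult_right_mono) auto
    qed
  qed
  also have "\<dots> < (\<Sum>c\<in>B - A. t)"
    using small \<open>B - A \<noteq> {}\<close> full_finite[OF B] by (intro sum_strict_mono) auto
  finally show False by (simp add: m_def mult.commute)
qed

text \<open>For \<open>B = A\<close> there is no candidate to insert, and the claim rests on
  balanced weights maximizing the least support. Otherwise a candidate with prescore at least
  \<open>t\<close> at a threshold \<open>t\<close> above the support of \<open>A\<close> would have
  too high a score.\<close>

lemma score_condition_approx:
  assumes A: "full el A" and bal: "balanced el A w" and sc: "score_condition el A w"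
    and B: "full el B" and v: "feasible el v"
  shows "min_supp el v B \<le> 3 * min_supp el w A"
proof (rule ccontr)
  assume neg: "\<not> min_supp el v B \<le> 3 * min_supp el w A"
  have w: "feasible el w" using bal by (auto simp: balanced_iff[OF full_subset[OF A]] exhaustive_def)
  note T0 = min_supp_nonneg[OF A w]
  show False
  proof (cases "A = B")
    case True
    obtain d where "d \<in> A" "min_supp el w A = supp el w d" using min_supp_in[OF A] by auto
    then have "min_supp el v B \<le> min_supp el w A"
      using balanced_supp_ge[OF full_subset[OF A] bal v, of "min_supp el v B" d] min_supp_le[OF B] True
      by auto
    then show False using neg T0 by linarith
  next
    case False
    define t where "t = min_supp el v B / 3"
    have t: "min_supp el w A < t" "0 < t" using neg T0 by (auto simp: t_def)
    obtain c where c: "c \<in> B - A" "t \<le> prescore el A w c t"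
      using balanced_prescore_large[OF A bal B v False t(2)] by (auto simp: t_def)
    have "score el A w c \<le> min_supp el w A"
      using sc c full_subset[OF B] by (auto simp: score_condition_iff_prescore[OF A w] score_le_iff[OF w])
    moreover have "prescore el A w c t \<le> prescore el A w c (min_supp el w A)"
      using t by (intro prescore_antimono[OF w]) simp
    ultimately show False using t c by (simp add: score_le_iff[OF w])
  qed
qed


section \<open>The balanced greedy algorithm\<close>

text \<open>Supplies a feasible competitor for the rebalancing that follows an insertion. It need
  not be the vector \<open>insert_weights\<close>, as \<open>rebalancing\<close> does not depend on
  the weights it replaces. Here all voters are scaled, so the supports can be computed exactly, and
  the new candidate receives its prescore, which equals its score.\<close>

lemma insertion_supports:
  assumes w: "feasible el w" and A: "A \<subseteq> cands el" and c: "c \<in> cands el - A"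
  obtains v where "feasible el v" "\<And>d. d \<in> A \<Longrightarrow> min (supp el w d) (score el A w c) \<le> supp el v d"
    "score el A w c \<le> supp el v c"
proof -
  define t where "t = score el A w c"
  have t: "0 \<le> t" "prescore el A w c t = t" using score_fixpoint[OF w] by (auto simp: t_def)
  define v where "v = (\<lambda>(n, d). if d \<in> A then w (n, d) * min 1 (t / supp el w d)
    else if d = c then slack el A w n t else 0)"
  have "0 \<le> v (n, d)" if "(n, d) \<in> edges el" for n d
    using that edges_subset t feasible_nonneg[OF w, of n d] supp_nonneg[OF w, of d] slack_nonneg[OF w, of n A t]
    by (auto simp: v_def approvers_def)
  moreover have "(\<Sum>d\<in>approved el n. v (n, d)) \<le> strength el n" if n: "n \<in> voters el" for n
  proof -
    have "(\<Sum>d\<in>approved el n. v (n, d)) =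
        (\<Sum>d\<in>approved el n \<inter> A. v (n, d)) + (\<Sum>d\<in>approved el n - A. v (n, d))"
      by (intro sum.Int_Diff) simp
    also have "(\<Sum>d\<in>approved el n - A. v (n, d)) = (\<Sum>d\<in>approved el n - A. if d = c then slack el A w n t else 0)"
      by (intro sum.cong) (auto simp: v_def)
    also have "\<dots> \<le> slack el A w n t" using slack_nonneg[OF w n] by simp
    also have "(\<Sum>d\<in>approved el n \<inter> A. v (n, d)) = strength el n - slack el A w n t"
      by (simp add: slack_def v_def Int_commute)
    finally show ?thesis by simp
  qed
  ultimately have "feasible el v" by (auto simp: feasible_def)
  moreover have "min (supp el w d) t \<le> supp el v d" if "d \<in> A" for d
  proof -
    have "supp el v d = supp el w d * min 1 (t / supp el w d)"
      using that by (simp add: supp_def v_def sum_distrib_right)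
    then show ?thesis using t supp_nonneg[OF w, of d] by (cases "supp el w d = 0") (auto simp: min_def field_simps)
  qed
  moreover have "supp el v c = t"
    using c t by (simp add: supp_def v_def prescore_def)
  ultimately show ?thesis using that[of v] by (simp add: t_def)
qed

text \<open>The score condition is stated with quantifiers in place of \<open>Max\<close> and
  \<open>Min\<close>, so that it makes sense for the empty committee.\<close>

definition greedy_invariant :: "nat \<Rightarrow> 'c set \<Rightarrow> ('n, 'c) weights \<Rightarrow> bool" where
  "greedy_invariant i A w \<longleftrightarrow> A \<subseteq> cands el \<and> card A = i \<and> balanced el A w \<and>
     (\<forall>c\<in>cands el - A. \<forall>d\<in>A. score el A w c \<le> supp el w d)"

lemma greedy_invariant_start: "greedy_invariant 0 {} (\<lambda>_. 0)"
  by (auto simp: greedy_invariant_def balanced_iff exhaustive_def concentrated_def feasible_def strength_nonneg)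

text \<open>After the insertion every support can be kept at least at the highest old score.
  Rebalancing preserves this bound by \<open>balanced_supp_ge\<close>, and the remaining scores do
  not exceed the old ones.\<close>

lemma greedy_invariant_step:
  assumes inv: "greedy_invariant i A w" and step: "(insertion el OO rebalancing el) (A, w) (B, v)"
  shows "greedy_invariant (Suc i) B v"
proof -
  obtain c where c: "c \<in> cands el - A" and best: "\<And>b. b \<in> cands el - A \<Longrightarrow> score el A w b \<le> score el A w c"
    and B: "B = insert c A" and v: "balanced el B v"
    using step by (auto simp: insertion_def rebalancing_def)
  have A: "A \<subseteq> cands el" and w: "balanced el A w"
    and scores: "\<And>c d. c \<in> cands el - A \<Longrightarrow> d \<in> A \<Longrightarrow> score el A w c \<le> supp el w d"
    using inv by (auto simp: greedy_invariant_def)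
  have BC: "B \<subseteq> cands el" using A B c by simp
  have fw: "feasible el w" using w by (simp add: balanced_iff[OF A] exhaustive_def)
  obtain u where u: "feasible el u" "\<And>d. d \<in> A \<Longrightarrow> min (supp el w d) (score el A w c) \<le> supp el u d"
    "score el A w c \<le> supp el u c"
    using insertion_supports[OF fw A c] by blast
  have "score el A w c \<le> supp el u d" if "d \<in> B" for d
    using that B u(2)[of d] u(3) scores[OF c, of d] by (auto simp: min_def split: if_splits)
  then have ge: "score el A w c \<le> supp el v d" if "d \<in> B" for d
    using that balanced_supp_ge[OF BC v u(1)] by blast
  have "score el B v b \<le> supp el v d" if "b \<in> cands el - B" "d \<in> B" for b d
  proof -
    have "score el B v b \<le> score el A w b" using B by (intro balanced_score_antimono[OF _ BC w v]) auto
    also have "\<dots> \<le> score el A w c" using best that B by auto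
    also have "\<dots> \<le> supp el v d" using ge that by blast
    finally show ?thesis .
  qed
  then show ?thesis
    using inv B BC c v finite_committee[OF A] by (auto simp: greedy_invariant_def)
qed

lemma greedy_invariant_iterate:
  "((insertion el OO rebalancing el) ^^ i) ({}, \<lambda>_. 0) (A, w) \<Longrightarrow> greedy_invariant i A w"
proof (induction i arbitrary: A w)
  case 0
  then show ?case using greedy_invariant_start by auto
next
  case (Suc i)
  then obtain A' w' where "((insertion el OO rebalancing el) ^^ i) ({}, \<lambda>_. 0) (A', w')"
    "(insertion el OO rebalancing el) (A', w') (A, w)" by (auto simp del: relcompp_apply)
  then show ?case using Suc.IH greedy_invariant_step by blast
qed

text \<open>The iteration never gets stuck, so the correctness of greedy outputs is not
  vacuous.\<close>

lemma greedy_iterate_exists: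
  assumes "i \<le> card (cands el)"
  shows "\<exists>A w. ((insertion el OO rebalancing el) ^^ i) ({}, \<lambda>_. 0) (A, w)"
  using assms
proof (induction i)
  case 0
  then show ?case by auto
next
  case (Suc i)
  then obtain A w where Aw: "((insertion el OO rebalancing el) ^^ i) ({}, \<lambda>_. 0) (A, w)" by auto
  then have A: "A \<subseteq> cands el" "card A = i"
    using greedy_invariant_iterate by (auto simp: greedy_invariant_def)
  then have "cands el - A \<noteq> {}"
    using Suc.prems card_mono[OF finite_committee[OF A(1)], of "cands el"] by auto
  then obtain c where c: "c \<in> cands el - A" "\<And>b. b \<in> cands el - A \<Longrightarrow> score el A w b \<le> score el A w c"
  proof -
    have "Max (score el A w ` (cands el - A)) \<in> score el A w ` (cands el - A)"
      using \<open>cands el - A \<noteq> {}\<close> finite_cands by (intro Max_in) auto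
    then obtain c where "c \<in> cands el - A" "score el A w c = Max (score el A w ` (cands el - A))" by auto
    then show ?thesis using finite_cands by (intro that[of c]) simp_all
  qed
  have "insert c A \<subseteq> cands el" using A c by simp
  then obtain v where "balanced el (insert c A) v" using balanced_exists by blast
  then have "(insertion el OO rebalancing el) (A, w) (insert c A, v)"
    using c by (auto simp: insertion_def rebalancing_def)
  then show ?case using Aw by (auto simp del: relcompp_apply)
qed

lemma greedy_output_exists: "\<exists>A w. greedy_output el A w"
  using greedy_iterate_exists csize_less by (simp add: greedy_output_def)

lemma greedy_output_correct:
  assumes "greedy_output el A w"
  shows "full el A" "feasible el w" "balanced el A w" "score_condition el A w"
proof -
  have inv: "greedy_invariant (csize el) A w"
    using assms greedy_invariant_iterate by (simp add: greedy_output_def)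
  then show "full el A" "balanced el A w" by (auto simp: greedy_invariant_def full_def)
  then show "feasible el w" by (auto simp: balanced_iff[OF full_subset] exhaustive_def)
  show "score_condition el A w"
    using inv \<open>full el A\<close> by (simp add: greedy_invariant_def score_condition_iff_score)
qed

end


section \<open>Loops on the real RAM\<close>

text \<open>Cost per unit of the bound on the number of iterations. A loop body is charged once,
  which fits programs without nested loops; the doubled test in the \<open>While\<close> case pays
  for the final failing test.\<close>

primrec cost_factor :: "com \<Rightarrow> nat" where
  "cost_factor Skip = 1"
| "cost_factor (NWrite x i a) = 1 + ncost i + ncost a"
| "cost_factor (RWrite x i a) = 1 + ncost i + rcost a"
| "cost_factor (Seq p q) = 1 + cost_factor p + cost_factor q"
| "cost_factor (Cond b p q) = 1 + bcost b + cost_factor p + cost_factor q"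
| "cost_factor (While b p) = 2 * (1 + bcost b) + cost_factor p"

text \<open>The cells of \<open>''i''\<close>, the loop counter, are the only natural-number memory that changes, so
  the effect of a command is a map on the real memory; \<open>m\<close> bounds the number of iterations
  of each loop.\<close>

definition transforms ::
  "nat \<Rightarrow> (vname \<Rightarrow> nat \<Rightarrow> nat) \<Rightarrow> com \<Rightarrow> (vname \<Rightarrow> nat \<Rightarrow> real) \<Rightarrow> (vname \<Rightarrow> nat \<Rightarrow> real) \<Rightarrow> bool"
where
  "transforms m nm c r r' \<longleftrightarrow> (\<forall>x. \<exists>t x'.
     exec c \<lparr>nmem = nm(''i'' := x), rmem = r\<rparr> t \<lparr>nmem = nm(''i'' := x'), rmem = r'\<rparr> \<and>
     t \<le> cost_factor c * m)"

lemma transforms_Seq: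
  assumes "transforms m nm p r r'" "transforms m nm q r' r''" "1 \<le> m"
  shows "transforms m nm (Seq p q) r r''"
  unfolding transforms_def
proof
  fix x
  obtain t x' where p: "exec p \<lparr>nmem = nm(''i'' := x), rmem = r\<rparr> t \<lparr>nmem = nm(''i'' := x'), rmem = r'\<rparr>"
    "t \<le> cost_factor p * m" using assms(1) unfolding transforms_def by blast
  obtain u x'' where q: "exec q \<lparr>nmem = nm(''i'' := x'), rmem = r'\<rparr> u \<lparr>nmem = nm(''i'' := x''), rmem = r''\<rparr>"
    "u \<le> cost_factor q * m" using assms(2) unfolding transforms_def by blast
  have "1 + t + u \<le> cost_factor (Seq p q) * m"
    using p(2) q(2) assms(3) by (simp add: algebra_simps)
  then show "\<exists>t x'. exec (Seq p q) \<lparr>nmem = nm(''i'' := x), rmem = r\<rparr> t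
      \<lparr>nmem = nm(''i'' := x'), rmem = r''\<rparr> \<and> t \<le> cost_factor (Seq p q) * m"
    using exec.Seq[OF p(1) q(1)] by blast
qed

lemma transforms_RWrite:
  assumes "\<And>x. nval idx \<lparr>nmem = nm(''i'' := x), rmem = r\<rparr> = j"
    "\<And>x. rval e \<lparr>nmem = nm(''i'' := x), rmem = r\<rparr> = v" "1 \<le> m"
  shows "transforms m nm (RWrite a idx e) r (r(a := (r a)(j := v)))"
  unfolding transforms_def
proof
  fix x
  have "exec (RWrite a idx e) \<lparr>nmem = nm(''i'' := x), rmem = r\<rparr> (1 + ncost idx + rcost e)
      \<lparr>nmem = nm(''i'' := x), rmem = r(a := (r a)(j := v))\<rparr>"
    using exec.RWrite[of a idx e "\<lparr>nmem = nm(''i'' := x), rmem = r\<rparr>"] assms(1,2) by (simp add: rwrite_def)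
  then show "\<exists>t x'. exec (RWrite a idx e) \<lparr>nmem = nm(''i'' := x), rmem = r\<rparr> t
      \<lparr>nmem = nm(''i'' := x'), rmem = r(a := (r a)(j := v))\<rparr> \<and> t \<le> cost_factor (RWrite a idx e) * m"
    using assms(3) by (fastforce simp del: One_nat_def)
qed

definition counter :: nexp where
  "counter = NRead ''i'' (NConst 0)"

text \<open>One guarded write into one real array per pass, so that a loop is described by the
  successive contents of that array.\<close>

definition loop :: "vname \<Rightarrow> bexp \<Rightarrow> vname \<Rightarrow> nexp \<Rightarrow> rexp \<Rightarrow> com" where
  "loop N b a idx e = Seq (NWrite ''i'' (NConst 0) (NConst 0))
     (While (NLess counter (NRead N (NConst 0)))
       (Seq (Cond b (RWrite a idx e) Skip) (NWrite ''i'' (NConst 0) (NPlus counter (NConst 1)))))"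

text \<open>\<open>Y l\<close> is the content of array \<open>a\<close> after \<open>l\<close>
  passes; the rule reduces a loop to a recurrence for \<open>Y\<close>. The proof is an induction on
  the number of remaining passes.\<close>

lemma transforms_loop:
  assumes N: "N \<noteq> ''i''" "nm N 0 = n" and m: "n \<le> m" "1 \<le> m"
    and Y0: "Y 0 = r a"
    and step: "\<And>l x. l < n \<Longrightarrow> x 0 = l \<Longrightarrow> Y (Suc l) =
      (if bval b \<lparr>nmem = nm(''i'' := x), rmem = r(a := Y l)\<rparr>
       then (Y l)(nval idx \<lparr>nmem = nm(''i'' := x), rmem = r(a := Y l)\<rparr> :=
         rval e \<lparr>nmem = nm(''i'' := x), rmem = r(a := Y l)\<rparr>)
       else Y l)"
  shows "transforms m nm (loop N b a idx e) r (r(a := Y n))"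
proof -
  define cond where "cond = NLess counter (NRead N (NConst 0))"
  define upd where "upd = Cond b (RWrite a idx e) Skip"
  define incr where "incr = NWrite ''i'' (NConst 0) (NPlus counter (NConst 1))"
  define mem where "mem x l = \<lparr>nmem = nm(''i'' := x), rmem = r(a := Y l)\<rparr>" for x l
  define q where "q = 1 + bcost cond + cost_factor (Seq upd incr)"
  have cond: "bval cond (mem x l) \<longleftrightarrow> x 0 < n" for x l
    using N by (simp add: cond_def counter_def mem_def)
  have upd: "\<exists>t. exec upd (mem x l) t (mem x (Suc l)) \<and> t \<le> cost_factor upd" if "l < n" "x 0 = l" for x l
  proof (cases "bval b (mem x l)")
    case True
    then have "rwrite a (nval idx (mem x l)) (rval e (mem x l)) (mem x l) = mem x (Suc l)"
      using step[of l x] that by (simp add: rwrite_def mem_def)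
    then have "exec (RWrite a idx e) (mem x l) (1 + ncost idx + rcost e) (mem x (Suc l))"
      using exec.RWrite by metis
    from exec.CondTrue[OF True this, of Skip] show ?thesis unfolding upd_def by fastforce
  next
    case False
    then have "mem x (Suc l) = mem x l" using step[of l x] that by (simp add: mem_def)
    then have "exec Skip (mem x l) 1 (mem x (Suc l))" using exec.Skip by simp
    from exec.CondFalse[OF False this, of "RWrite a idx e"] show ?thesis unfolding upd_def by fastforce
  qed
  have body: "\<exists>t. exec (Seq upd incr) (mem x l) t (mem (x(0 := Suc l)) (Suc l)) \<and> t \<le> cost_factor (Seq upd incr)"
    if lx: "l < n" "x 0 = l" for x l
  proof -
    obtain t where t: "exec upd (mem x l) t (mem x (Suc l))" "t \<le> cost_factor upd"
      using upd[of l x, OF lx] by blast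
    have "nwrite ''i'' 0 (Suc l) (mem x (Suc l)) = mem (x(0 := Suc l)) (Suc l)"
      by (simp add: nwrite_def mem_def)
    then have "exec incr (mem x (Suc l)) (cost_factor incr) (mem (x(0 := Suc l)) (Suc l))"
      using exec.NWrite[of "''i''" "NConst 0" "NPlus counter (NConst 1)" "mem x (Suc l)"] lx
      by (simp add: incr_def counter_def mem_def)
    from exec.Seq[OF t(1) this] show ?thesis using t(2) by fastforce
  qed
  \<comment> \<open>Here \<open>q\<close> pays for one pass including its test, and the last summand
    for the failing test.\<close>
  have while: "\<exists>t x'. exec (While cond (Seq upd incr)) (mem x l) t (mem x' n) \<and> t \<le> d * q + (1 + bcost cond)"
    if "l + d = n" "x 0 = l" for d l x
    using that
  proof (induction d arbitrary: l x)
    case 0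
    then have "\<not> bval cond (mem x l)" by (simp add: cond)
    from exec.WhileFalse[OF this] show ?case using 0 by force
  next
    case (Suc d)
    then have b: "bval cond (mem x l)" by (simp add: cond)
    obtain t where t: "exec (Seq upd incr) (mem x l) t (mem (x(0 := Suc l)) (Suc l))"
      "t \<le> cost_factor (Seq upd incr)" using body[of l x] Suc.prems by auto
    obtain u x' where u: "exec (While cond (Seq upd incr)) (mem (x(0 := Suc l)) (Suc l)) u (mem x' n)"
      "u \<le> d * q + (1 + bcost cond)" using Suc.IH[of "Suc l" "x(0 := Suc l)"] Suc.prems by (auto simp del: fun_upd_apply simp: fun_upd_same)
    have "1 + bcost cond + t + u \<le> Suc d * q + (1 + bcost cond)"
      using t(2) u(2) by (simp add: q_def)
    then show ?case using exec.WhileTrue[OF b t(1) u(1)] by blast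
  qed
  show ?thesis
    unfolding transforms_def
  proof
    fix x
    obtain t x' where t: "exec (While cond (Seq upd incr)) (mem (x(0 := 0)) 0) t (mem x' n)"
      "t \<le> n * q + (1 + bcost cond)" using while[of 0 n "x(0 := 0)"] by auto
    have "exec (NWrite ''i'' (NConst 0) (NConst 0)) \<lparr>nmem = nm(''i'' := x), rmem = r\<rparr> 3 (mem (x(0 := 0)) 0)"
      using exec.NWrite[of "''i''" "NConst 0" "NConst 0" "\<lparr>nmem = nm(''i'' := x), rmem = r\<rparr>"]
      by (simp add: nwrite_def mem_def Y0 eval_nat_numeral)
    from exec.Seq[OF this t(1)]
    have ex: "exec (loop N b a idx e) \<lparr>nmem = nm(''i'' := x), rmem = r\<rparr> (1 + 3 + t) (mem x' n)"
      by (simp add: loop_def cond_def upd_def incr_def)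
    have "1 + 3 + t \<le> 4 * m + m * q + (1 + bcost cond) * m"
    proof -
      have "bcost cond \<le> bcost cond * m" using m by simp
      then show ?thesis
        using t(2) m(2) mult_le_mono1[OF m(1), of q] by (simp only: add_mult_distrib)
    qed
    also have "\<dots> = cost_factor (loop N b a idx e) * m"
      by (simp add: loop_def q_def cond_def upd_def incr_def counter_def algebra_simps)
    finally show "\<exists>t x'. exec (loop N b a idx e) \<lparr>nmem = nm(''i'' := x), rmem = r\<rparr> t
        \<lparr>nmem = nm(''i'' := x'), rmem = r(a := Y n)\<rparr> \<and> t \<le> cost_factor (loop N b a idx e) * m"
      using ex by (auto simp: mem_def)
  qed
qed

section \<open>Loops that fill, sum, minimize and count\<close>

definition always :: bexp where
  "always = NLess (NConst 0) (NConst 1)"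

definition fill :: "vname \<Rightarrow> vname \<Rightarrow> rexp \<Rightarrow> com" where
  "fill N a e = loop N always a counter e"

definition accumulate :: "vname \<Rightarrow> bexp \<Rightarrow> vname \<Rightarrow> nexp \<Rightarrow> rexp \<Rightarrow> com" where
  "accumulate N b a idx e = loop N b a idx (RPlus (RRead a idx) e)"

definition minimize :: "vname \<Rightarrow> bexp \<Rightarrow> vname \<Rightarrow> nexp \<Rightarrow> rexp \<Rightarrow> com" where
  "minimize N b a idx e = loop N (BAnd b (RLess e (RRead a idx))) a idx e"

lemma transforms_fill:
  assumes N: "N \<noteq> ''i''" "nm N 0 = n" and m: "n \<le> m" "1 \<le> m"
    and e: "\<And>l x y. l < n \<Longrightarrow> x 0 = l \<Longrightarrow> rval e \<lparr>nmem = nm(''i'' := x), rmem = r(a := y)\<rparr> = v l"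
  shows "transforms m nm (fill N a e) r (r(a := \<lambda>j. if j < n then v j else r a j))"
  unfolding fill_def
  by (rule transforms_loop[where N = N and nm = nm and n = n and r = r and a = a and
        Y = "\<lambda>l j. if j < l then v j else r a j", OF N m])
     (auto simp: e always_def counter_def)

text \<open>Each index \<open>l\<close> is added to its own cell \<open>ix l\<close>, so a single
  pass over an unsorted edge list computes the sums of all voters or all candidates at once.\<close>

lemma transforms_accumulate:
  assumes N: "N \<noteq> ''i''" "nm N 0 = n" and m: "n \<le> m" "1 \<le> m"
    and eval: "\<And>l x y. l < n \<Longrightarrow> x 0 = l \<Longrightarrow>
      bval b \<lparr>nmem = nm(''i'' := x), rmem = r(a := y)\<rparr> = P l \<and>
      nval idx \<lparr>nmem = nm(''i'' := x), rmem = r(a := y)\<rparr> = ix l \<and>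
      rval e \<lparr>nmem = nm(''i'' := x), rmem = r(a := y)\<rparr> = v l"
  shows "transforms m nm (accumulate N b a idx e) r
    (r(a := \<lambda>j. r a j + (\<Sum>l | l < n \<and> P l \<and> ix l = j. v l)))"
proof -
  have "{l. l < Suc k \<and> P l \<and> ix l = j} =
      (if P k \<and> ix k = j then insert k {l. l < k \<and> P l \<and> ix l = j} else {l. l < k \<and> P l \<and> ix l = j})" for j k
    by (auto simp: less_Suc_eq)
  then have sums: "(\<Sum>l | l < Suc k \<and> P l \<and> ix l = j. v l) =
      (\<Sum>l | l < k \<and> P l \<and> ix l = j. v l) + (if P k \<and> ix k = j then v k else 0)" for j k
    by simp
  define Y where "Y k j = r a j + (\<Sum>l | l < k \<and> P l \<and> ix l = j. v l)" for k j
  have Y: "Y (Suc k) = (\<lambda>j. if P k \<and> ix k = j then Y k j + v k else Y k j)" "Y 0 = r a" for k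
    by (auto simp: Y_def sums)
  have "transforms m nm (loop N b a idx (RPlus (RRead a idx) e)) r (r(a := Y n))"
    by (rule transforms_loop[where N = N and nm = nm and n = n and r = r and a = a and Y = Y, OF N m Y(2)])
       (auto simp: Y(1) eval)
  then show ?thesis unfolding accumulate_def Y_def .
qed

text \<open>The old content of a cell takes part in its minimum, so the caller has to start it at an
  upper bound.\<close>

lemma transforms_minimize:
  assumes N: "N \<noteq> ''i''" "nm N 0 = n" and m: "n \<le> m" "1 \<le> m"
    and eval: "\<And>l x y. l < n \<Longrightarrow> x 0 = l \<Longrightarrow>
      bval b \<lparr>nmem = nm(''i'' := x), rmem = r(a := y)\<rparr> = P l \<and>
      nval idx \<lparr>nmem = nm(''i'' := x), rmem = r(a := y)\<rparr> = ix l \<and>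
      rval e \<lparr>nmem = nm(''i'' := x), rmem = r(a := y)\<rparr> = v l"
  shows "transforms m nm (minimize N b a idx e) r
    (r(a := \<lambda>j. Min (insert (r a j) (v ` {l. l < n \<and> P l \<and> ix l = j}))))"
proof -
  define M where "M k j = Min (insert (r a j) (v ` {l. l < k \<and> P l \<and> ix l = j}))" for k j
  have "{l. l < Suc k \<and> P l \<and> ix l = j} =
      (if P k \<and> ix k = j then insert k {l. l < k \<and> P l \<and> ix l = j} else {l. l < k \<and> P l \<and> ix l = j})" for j k
    by (auto simp: less_Suc_eq)
  then have "insert (r a j) (v ` {l. l < Suc k \<and> P l \<and> ix l = j}) =
      (if P k \<and> ix k = j then insert (v k) (insert (r a j) (v ` {l. l < k \<and> P l \<and> ix l = j}))
       else insert (r a j) (v ` {l. l < k \<and> P l \<and> ix l = j}))" for j k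
    by auto
  then have M: "M (Suc k) = (\<lambda>j. if P k \<and> ix k = j then min (v k) (M k j) else M k j)" for k
    unfolding M_def by (subst Min_insert[symmetric]) auto
  have M0: "M 0 = r a" by (auto simp: M_def)
  have "transforms m nm (loop N (BAnd b (RLess e (RRead a idx))) a idx e) r (r(a := M n))"
    by (rule transforms_loop[where N = N and nm = nm and n = n and r = r and a = a and Y = M, OF N m M0])
       (auto simp: M eval min_def fun_eq_iff)
  then show ?thesis unfolding minimize_def M_def .
qed

lemma transforms_Skip: "1 \<le> m \<Longrightarrow> transforms m nm Skip r r"
  unfolding transforms_def using exec.Skip by fastforce

text \<open>Violations are counted in a real cell because \<open>transforms\<close> lets no
  natural-number memory change except the loop counter.\<close>

definition report :: "vname \<Rightarrow> bexp \<Rightarrow> com" where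
  "report N b = accumulate N b ''bad'' (NConst 0) (RConst 1)"

lemma transforms_report:
  assumes N: "N \<noteq> ''i''" "nm N 0 = n" and m: "n \<le> m" "1 \<le> m" and bad: "0 \<le> r ''bad'' 0"
    and eval: "\<And>l x y. l < n \<Longrightarrow> x 0 = l \<Longrightarrow>
      bval b \<lparr>nmem = nm(''i'' := x), rmem = r(''bad'' := y)\<rparr> = P l"
  obtains y where "transforms m nm (report N b) r (r(''bad'' := y))" "0 \<le> y 0"
    "y 0 = 0 \<longleftrightarrow> r ''bad'' 0 = 0 \<and> (\<forall>l<n. \<not> P l)"
proof
  define y where "y = (\<lambda>j. r ''bad'' j + (\<Sum>l | l < n \<and> P l \<and> 0 = j. 1))"
  show "transforms m nm (report N b) r (r(''bad'' := y))"
    unfolding report_def y_def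
    by (rule transforms_accumulate[where N = N and nm = nm and n = n and ix = "\<lambda>_. 0", OF N m])
       (simp add: eval)
  have y0: "y 0 = r ''bad'' 0 + real (card {l. l < n \<and> P l})" by (simp add: y_def)
  then show "0 \<le> y 0" using bad by simp
  have "card {l. l < n \<and> P l} = 0 \<longleftrightarrow> (\<forall>l<n. \<not> P l)" by auto
  then show "y 0 = 0 \<longleftrightarrow> r ''bad'' 0 = 0 \<and> (\<forall>l<n. \<not> P l)"
    unfolding y0 using bad by (simp only: add_nonneg_eq_0_iff of_nat_0_le_iff of_nat_eq_0_iff)
qed


section \<open>Testing the conditions in linear time\<close>

definition edge_voter :: nexp where
  "edge_voter = NRead ''voter'' counter"

definition edge_cand :: nexp where
  "edge_cand = NRead ''cand'' counter"

definition cand_elected :: "nexp \<Rightarrow> bexp" where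
  "cand_elected j = NLess (NConst 0) (NRead ''elected'' j)"

definition edge_weight :: rexp where
  "edge_weight = RRead ''weight'' counter"

definition tally_voters :: "vname \<Rightarrow> rexp \<Rightarrow> bexp \<Rightarrow> rexp \<Rightarrow> com" where
  "tally_voters a e\<^sub>0 b e = Seq (fill ''voters'' a e\<^sub>0) (accumulate ''edges'' b a edge_voter e)"

definition tally_cands :: "vname \<Rightarrow> bexp \<Rightarrow> rexp \<Rightarrow> com" where
  "tally_cands a b e = Seq (fill ''cands'' a (RConst 0)) (accumulate ''edges'' b a edge_cand e)"

text \<open>In turn: sums per voter and per candidate, feasibility, exhaustiveness, concentration,
  and the prescores at the least support of the committee. The sum of all weights plays the role of
  infinity as start of the minima.\<close>

definition test_steps :: "com list" where
  "test_steps =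
    [RWrite ''bad'' (NConst 0) (RConst 0),
     RWrite ''total'' (NConst 0) (RConst 0),
     accumulate ''edges'' always ''total'' (NConst 0) edge_weight,
     tally_voters ''used'' (RConst 0) always edge_weight,
     tally_voters ''spent'' (RConst 0) (cand_elected edge_cand) edge_weight,
     tally_cands ''supp'' always edge_weight,
     report ''edges'' (RLess edge_weight (RConst 0)),
     report ''voters'' (RLess (RRead ''strength'' counter) (RRead ''used'' counter)),
     report ''edges'' (BAnd (cand_elected edge_cand)
       (RLess (RRead ''spent'' edge_voter) (RRead ''strength'' edge_voter))),
     fill ''voters'' ''level'' (RRead ''total'' (NConst 0)),
     minimize ''edges'' (cand_elected edge_cand) ''level'' edge_voter (RRead ''supp'' edge_cand),
     report ''edges'' (BAnd (cand_elected edge_cand) (BAnd (RLess (RConst 0) edge_weight)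
       (RLess (RRead ''level'' edge_voter) (RRead ''supp'' edge_cand)))),
     RWrite ''threshold'' (NConst 0) (RRead ''total'' (NConst 0)),
     minimize ''cands'' (cand_elected counter) ''threshold'' (NConst 0) (RRead ''supp'' counter),
     tally_voters ''slack'' (RRead ''strength'' counter) (cand_elected edge_cand)
       (RMinus (RConst 0)
         (RTimes edge_weight (RDivide (RRead ''threshold'' (NConst 0)) (RRead ''supp'' edge_cand)))),
     tally_cands ''prescore'' (BNot (cand_elected edge_cand)) (RRead ''slack'' edge_voter),
     report ''cands'' (BAnd (BNot (cand_elected counter))
       (RLess (RRead ''threshold'' (NConst 0)) (RRead ''prescore'' counter)))]"

definition test_prog :: com where
  "test_prog = Seq (foldr Seq test_steps Skip)
     (Cond (RLess (RConst 0) (RRead ''bad'' (NConst 0)))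
       (NWrite ''accept'' (NConst 0) (NConst 0)) (NWrite ''accept'' (NConst 0) (NConst 1)))"

lemma all_bij_betw_lessThan:
  "bij_betw f {..<k} S \<Longrightarrow> (\<forall>i<k. Q (f i)) \<longleftrightarrow> (\<forall>x\<in>S. Q x)"
  by (auto simp: bij_betw_def)

text \<open>Fixes the numberings whose existence \<open>encodes\<close> asserts, so that arrays can
  be read as functions of voters, candidates and edges.\<close>

locale encoded_election = approval_election el for el :: "('n, 'c) election" +
  fixes \<sigma> :: state and A :: "'c set" and w :: "('n, 'c) weights"
    and vt :: "nat \<Rightarrow> 'n" and cd :: "nat \<Rightarrow> 'c" and ed :: "nat \<Rightarrow> 'n \<times> 'c"
  assumes full_A: "full el A"
    and nmem_voters: "nmem \<sigma> ''voters'' 0 = card (voters el)"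
    and nmem_cands: "nmem \<sigma> ''cands'' 0 = card (cands el)"
    and nmem_edges: "nmem \<sigma> ''edges'' 0 = card (edges el)"
    and bij_vt: "bij_betw vt {..<card (voters el)} (voters el)"
    and bij_cd: "bij_betw cd {..<card (cands el)} (cands el)"
    and bij_ed: "bij_betw ed {..<card (edges el)} (edges el)"
    and rmem_strength: "i < card (voters el) \<Longrightarrow> rmem \<sigma> ''strength'' i = strength el (vt i)"
    and nmem_elected: "j < card (cands el) \<Longrightarrow> nmem \<sigma> ''elected'' j = (if cd j \<in> A then 1 else 0)"
    and voter_less: "l < card (edges el) \<Longrightarrow> nmem \<sigma> ''voter'' l < card (voters el)"
    and cand_less: "l < card (edges el) \<Longrightarrow> nmem \<sigma> ''cand'' l < card (cands el)"
    and ed_eq: "l < card (edges el) \<Longrightarrow> ed l = (vt (nmem \<sigma> ''voter'' l), cd (nmem \<sigma> ''cand'' l))"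
    and rmem_weight: "l < card (edges el) \<Longrightarrow> rmem \<sigma> ''weight'' l = w (ed l)"
begin

section \<open>Reading edge numbers as edges\<close>

abbreviation V :: nat where "V \<equiv> card (voters el)"
abbreviation C :: nat where "C \<equiv> card (cands el)"
abbreviation E :: nat where "E \<equiv> card (edges el)"

definition ev :: "nat \<Rightarrow> 'n" where "ev l = vt (nmem \<sigma> ''voter'' l)"
definition ec :: "nat \<Rightarrow> 'c" where "ec l = cd (nmem \<sigma> ''cand'' l)"

text \<open>There are no isolated voters; this keeps the loops over all voters linear in the number
  of edges.\<close>

lemma voters_le_edges: "V \<le> E"
proof -
  have "n \<in> fst ` edges el" if n: "n \<in> voters el" for n
  proof -
    obtain c where "(n, c) \<in> edges el"
      using instance_el n unfolding election_instance_def approved_def by blast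
    then show ?thesis by (rule image_eqI[rotated]) simp
  qed
  then have "voters el \<subseteq> fst ` edges el" by blast
  then show ?thesis by (rule surj_card_le[OF finite_edges])
qed

lemma cands_le_edges: "C \<le> E"
proof -
  have "c \<in> snd ` edges el" if c: "c \<in> cands el" for c
  proof -
    obtain n where "(n, c) \<in> edges el"
      using instance_el c unfolding election_instance_def approvers_def by blast
    then show ?thesis by (rule image_eqI[rotated]) simp
  qed
  then have "cands el \<subseteq> snd ` edges el" by blast
  then show ?thesis by (rule surj_card_le[OF finite_edges])
qed

lemma edges_pos: "1 \<le> E"
  using cands_le_edges csize_less by simp

lemma edge_at: "l < E \<Longrightarrow> (ev l, ec l) \<in> edges el"
  using bij_betw_apply[OF bij_ed, of l] ed_eq[of l] by (simp add: ev_def ec_def)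

lemma edge_index: "(n, c) \<in> edges el \<Longrightarrow> \<exists>l<E. ev l = n \<and> ec l = c"
proof -
  assume "(n, c) \<in> edges el"
  then obtain l where "l < E" "ed l = (n, c)"
    using all_bij_betw_lessThan[OF bij_ed, of "\<lambda>e. e \<noteq> (n, c)"] by blast
  then show ?thesis using ed_eq[of l] by (auto simp: ev_def ec_def)
qed

lemma edge_inj: "l < E \<Longrightarrow> k < E \<Longrightarrow> ev l = ev k \<Longrightarrow> ec l = ec k \<Longrightarrow> l = k"
  using inj_onD[OF bij_betw_imp_inj_on[OF bij_ed], of l k] ed_eq[of l] ed_eq[of k]
  by (simp add: ev_def ec_def)

lemma vt_inj: "i < V \<Longrightarrow> j < V \<Longrightarrow> vt i = vt j \<longleftrightarrow> i = j"
  using inj_onD[OF bij_betw_imp_inj_on[OF bij_vt], of i j] by auto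

lemma cd_inj: "i < C \<Longrightarrow> j < C \<Longrightarrow> cd i = cd j \<longleftrightarrow> i = j"
  using inj_onD[OF bij_betw_imp_inj_on[OF bij_cd], of i j] by auto

lemma all_edges: "(\<forall>l<E. Q (ev l) (ec l)) \<longleftrightarrow> (\<forall>n. \<forall>c\<in>approved el n. Q n c)"
proof (intro iffI allI ballI impI)
  fix n c assume "\<forall>l<E. Q (ev l) (ec l)" "c \<in> approved el n"
  then show "Q n c" using edge_index[of n c] by (auto simp: approved_def)
next
  fix l assume "\<forall>n. \<forall>c\<in>approved el n. Q n c" "l < E"
  then show "Q (ev l) (ec l)" using edge_at[of l] by (auto simp: approved_def)
qed

lemma all_voters: "(\<forall>i<V. Q (vt i)) \<longleftrightarrow> (\<forall>n\<in>voters el. Q n)"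
  using all_bij_betw_lessThan[OF bij_vt] .

lemma all_cands: "(\<forall>j<C. Q (cd j)) \<longleftrightarrow> (\<forall>c\<in>cands el. Q c)"
  using all_bij_betw_lessThan[OF bij_cd] .

lemma bij_edges_of_voter:
  assumes "i < V"
  shows "bij_betw ec {l. l < E \<and> P (ec l) \<and> nmem \<sigma> ''voter'' l = i} {c \<in> approved el (vt i). P c}"
  unfolding bij_betw_def
proof
  show "inj_on ec {l. l < E \<and> P (ec l) \<and> nmem \<sigma> ''voter'' l = i}"
    by (intro inj_onI edge_inj) (auto simp: ev_def)
  have "c \<in> ec ` {l. l < E \<and> P (ec l) \<and> nmem \<sigma> ''voter'' l = i}" if c: "c \<in> approved el (vt i)" "P c" for c
  proof -
    obtain l where l: "l < E" "ev l = vt i" "ec l = c"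
      using edge_index[of "vt i" c] c by (auto simp: approved_def)
    then have "nmem \<sigma> ''voter'' l = i" using assms voter_less vt_inj by (simp add: ev_def)
    then show ?thesis using l c by blast
  qed
  moreover have "ec l \<in> approved el (vt (nmem \<sigma> ''voter'' l))" if "l < E" for l
    using edge_at[OF that] by (simp add: approved_def ev_def)
  ultimately show "ec ` {l. l < E \<and> P (ec l) \<and> nmem \<sigma> ''voter'' l = i} = {c \<in> approved el (vt i). P c}"
    by auto
qed

text \<open>The filter \<open>P\<close> looks at the candidate alone, so it selects all edges of
  candidate \<open>j\<close> or none; the assumption \<open>P (cd j)\<close> picks the first
  case.\<close>

lemma bij_edges_of_cand:
  assumes "j < C" "P (cd j)"
  shows "bij_betw ev {l. l < E \<and> P (ec l) \<and> nmem \<sigma> ''cand'' l = j} (approvers el (cd j))"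
  unfolding bij_betw_def
proof
  show "inj_on ev {l. l < E \<and> P (ec l) \<and> nmem \<sigma> ''cand'' l = j}"
    by (intro inj_onI edge_inj) (auto simp: ec_def)
  have "n \<in> ev ` {l. l < E \<and> P (ec l) \<and> nmem \<sigma> ''cand'' l = j}" if n: "n \<in> approvers el (cd j)" for n
  proof -
    obtain l where l: "l < E" "ev l = n" "ec l = cd j"
      using edge_index[of n "cd j"] n by (auto simp: approvers_def)
    then have "nmem \<sigma> ''cand'' l = j" using assms cand_less cd_inj by (simp add: ec_def)
    then show ?thesis using l assms by auto
  qed
  moreover have "ev l \<in> approvers el (cd (nmem \<sigma> ''cand'' l))" if "l < E" for l
    using edge_at[OF that] by (simp add: approvers_def ec_def)
  ultimately show "ev ` {l. l < E \<and> P (ec l) \<and> nmem \<sigma> ''cand'' l = j} = approvers el (cd j)"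
    by auto
qed

lemma sum_edges_of_voter:
  assumes "i < V"
  shows "(\<Sum>l | l < E \<and> P (ec l) \<and> nmem \<sigma> ''voter'' l = i. h (ev l) (ec l)) =
    (\<Sum>c | c \<in> approved el (vt i) \<and> P c. h (vt i) c)"
proof -
  have "(\<Sum>l | l < E \<and> P (ec l) \<and> nmem \<sigma> ''voter'' l = i. h (ev l) (ec l)) =
      (\<Sum>l | l < E \<and> P (ec l) \<and> nmem \<sigma> ''voter'' l = i. h (vt i) (ec l))"
    by (intro sum.cong) (auto simp: ev_def)
  also have "\<dots> = (\<Sum>c | c \<in> approved el (vt i) \<and> P c. h (vt i) c)"
    using sum.reindex_bij_betw[OF bij_edges_of_voter[OF assms]] .
  finally show ?thesis .
qed

lemma sum_edges_of_cand:
  assumes "j < C" "P (cd j)"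
  shows "(\<Sum>l | l < E \<and> P (ec l) \<and> nmem \<sigma> ''cand'' l = j. h (ev l) (ec l)) =
    (\<Sum>n\<in>approvers el (cd j). h n (cd j))"
proof -
  have "(\<Sum>l | l < E \<and> P (ec l) \<and> nmem \<sigma> ''cand'' l = j. h (ev l) (ec l)) =
      (\<Sum>l | l < E \<and> P (ec l) \<and> nmem \<sigma> ''cand'' l = j. h (ev l) (cd j))"
    by (intro sum.cong) (auto simp: ec_def)
  also have "\<dots> = (\<Sum>n\<in>approvers el (cd j). h n (cd j))"
    using sum.reindex_bij_betw[OF bij_edges_of_cand[of j P, OF assms], of "\<lambda>n. h n (cd j)"] .
  finally show ?thesis .
qed

section \<open>Sums per voter and per candidate\<close>

lemma transforms_tally_voters:
  assumes init: "\<And>l x y. l < V \<Longrightarrow> x 0 = l \<Longrightarrow>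
      rval e\<^sub>0 \<lparr>nmem = (nmem \<sigma>)(''i'' := x), rmem = r(a := y)\<rparr> = v (vt l)"
    and eval: "\<And>l x y. l < E \<Longrightarrow> x 0 = l \<Longrightarrow>
      bval b \<lparr>nmem = (nmem \<sigma>)(''i'' := x), rmem = r(a := y)\<rparr> = P (ec l) \<and>
      rval e \<lparr>nmem = (nmem \<sigma>)(''i'' := x), rmem = r(a := y)\<rparr> = h (ev l) (ec l)"
  obtains y where "transforms E (nmem \<sigma>) (tally_voters a e\<^sub>0 b e) r (r(a := y))"
    "\<forall>i<V. y i = v (vt i) + (\<Sum>c | c \<in> approved el (vt i) \<and> P c. h (vt i) c)"
proof -
  define y\<^sub>0 where "y\<^sub>0 = (\<lambda>j. if j < V then v (vt j) else r a j)"
  define y where "y = (\<lambda>j. y\<^sub>0 j + (\<Sum>l | l < E \<and> P (ec l) \<and> nmem \<sigma> ''voter'' l = j. h (ev l) (ec l)))"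
  have 1: "transforms E (nmem \<sigma>) (fill ''voters'' a e\<^sub>0) r (r(a := y\<^sub>0))"
    unfolding y\<^sub>0_def
    by (rule transforms_fill) (simp_all add: nmem_voters voters_le_edges edges_pos[simplified] init)
  have "transforms E (nmem \<sigma>) (accumulate ''edges'' b a edge_voter e) (r(a := y\<^sub>0))
      ((r(a := y\<^sub>0))(a := \<lambda>j. (r(a := y\<^sub>0)) a j +
        (\<Sum>l | l < E \<and> P (ec l) \<and> nmem \<sigma> ''voter'' l = j. h (ev l) (ec l))))"
    by (rule transforms_accumulate)
       (simp_all add: nmem_edges edges_pos[simplified] eval edge_voter_def counter_def)
  then have 2: "transforms E (nmem \<sigma>) (accumulate ''edges'' b a edge_voter e) (r(a := y\<^sub>0)) (r(a := y))"
    by (simp add: y_def)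
  show ?thesis
    using that[of y] transforms_Seq[OF 1 2 edges_pos]
    by (simp add: tally_voters_def y_def y\<^sub>0_def sum_edges_of_voter)
qed

lemma transforms_tally_cands:
  assumes eval: "\<And>l x y. l < E \<Longrightarrow> x 0 = l \<Longrightarrow>
      bval b \<lparr>nmem = (nmem \<sigma>)(''i'' := x), rmem = r(a := y)\<rparr> = P (ec l) \<and>
      rval e \<lparr>nmem = (nmem \<sigma>)(''i'' := x), rmem = r(a := y)\<rparr> = h (ev l) (ec l)"
  obtains y where "transforms E (nmem \<sigma>) (tally_cands a b e) r (r(a := y))"
    "\<forall>j<C. P (cd j) \<longrightarrow> y j = (\<Sum>n\<in>approvers el (cd j). h n (cd j))"
proof -
  define y\<^sub>0 where "y\<^sub>0 = (\<lambda>j. if j < C then 0 else r a j)"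
  define y where "y = (\<lambda>j. y\<^sub>0 j + (\<Sum>l | l < E \<and> P (ec l) \<and> nmem \<sigma> ''cand'' l = j. h (ev l) (ec l)))"
  have 1: "transforms E (nmem \<sigma>) (fill ''cands'' a (RConst 0)) r (r(a := y\<^sub>0))"
    unfolding y\<^sub>0_def
    by (rule transforms_fill) (simp_all add: nmem_cands cands_le_edges edges_pos[simplified])
  have "transforms E (nmem \<sigma>) (accumulate ''edges'' b a edge_cand e) (r(a := y\<^sub>0))
      ((r(a := y\<^sub>0))(a := \<lambda>j. (r(a := y\<^sub>0)) a j +
        (\<Sum>l | l < E \<and> P (ec l) \<and> nmem \<sigma> ''cand'' l = j. h (ev l) (ec l))))"
    by (rule transforms_accumulate)
       (simp_all add: nmem_edges edges_pos[simplified] eval edge_cand_def counter_def)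
  then have 2: "transforms E (nmem \<sigma>) (accumulate ''edges'' b a edge_cand e) (r(a := y\<^sub>0)) (r(a := y))"
    by (simp add: y_def)
  show ?thesis
    using that[of y] transforms_Seq[OF 1 2 edges_pos] sum_edges_of_cand[of _ P h]
    by (simp add: tally_cands_def y_def y\<^sub>0_def)
qed

lemmas evaluation = counter_def edge_voter_def edge_cand_def cand_elected_def edge_weight_def always_def
  nmem_voters nmem_cands nmem_edges nmem_elected rmem_strength rmem_weight voter_less cand_less ed_eq
  voters_le_edges cands_le_edges edges_pos[simplified] ev_def ec_def

definition total :: real where
  "total = (\<Sum>e\<in>edges el. w e)"

text \<open>For feasible weights \<open>total\<close> bounds every support, so these are the least support of
  a committee member approved by \<open>n\<close> and the least support of the committee.\<close>

definition level :: "'n \<Rightarrow> real" where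
  "level n = Min (insert total (supp el w ` (A \<inter> approved el n)))"

definition threshold :: real where
  "threshold = Min (insert total (supp el w ` A))"

text \<open>For feasible weights this is the slack at \<open>threshold\<close>: no member of
  \<open>A\<close> has a smaller support, so the quotient equals its minimum with 1.\<close>

definition slack_tally :: "'n \<Rightarrow> real" where
  "slack_tally n = strength el n + (\<Sum>c | c \<in> approved el n \<and> c \<in> A. 0 - w (n, c) * (threshold / supp el w c))"

definition passes :: bool where
  "passes \<longleftrightarrow> (\<forall>n. \<forall>c\<in>approved el n. \<not> w (n, c) < 0) \<and>
    (\<forall>n\<in>voters el. \<not> strength el n < (\<Sum>c\<in>approved el n. w (n, c))) \<and>
    (\<forall>n. \<forall>c\<in>approved el n. \<not> (c \<in> A \<and> (\<Sum>c\<in>A \<inter> approved el n. w (n, c)) < strength el n)) \<and>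
    (\<forall>n. \<forall>c\<in>approved el n. \<not> (c \<in> A \<and> 0 < w (n, c) \<and> level n < supp el w c)) \<and>
    (\<forall>c\<in>cands el. \<not> (c \<notin> A \<and> threshold < (\<Sum>n\<in>approvers el c. slack_tally n)))"

text \<open>Symbolic execution: the fact \<open>t\<close> with number K describes step K, the memory
  \<open>r\<close> with that number is the one after it, and \<open>y\<close> with that number is
  the array it has written. The facts \<open>r6\<close>, \<open>r11\<close>, \<open>r14\<close> and
  \<open>r14'\<close> collect the arrays that later steps read.\<close>

lemma transforms_test_steps:
  obtains r where "transforms E (nmem \<sigma>) (foldr Seq test_steps Skip) (rmem \<sigma>) r"
    "0 \<le> r ''bad'' 0" "r ''bad'' 0 = 0 \<longleftrightarrow> passes"
proof -
  define r1 where "r1 = (rmem \<sigma>)(''bad'' := (rmem \<sigma> ''bad'')(0 := 0))"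
  have t1: "transforms E (nmem \<sigma>) (RWrite ''bad'' (NConst 0) (RConst 0)) (rmem \<sigma>) r1"
    unfolding r1_def by (rule transforms_RWrite) (simp_all add: evaluation)
  define r2 where "r2 = r1(''total'' := (r1 ''total'')(0 := 0))"
  have t2: "transforms E (nmem \<sigma>) (RWrite ''total'' (NConst 0) (RConst 0)) r1 r2"
    unfolding r2_def by (rule transforms_RWrite) (simp_all add: evaluation)
  define r3 where "r3 = r2(''total'' := \<lambda>j. r2 ''total'' j + (\<Sum>l | l < E \<and> True \<and> 0 = j. w (ed l)))"
  have t3: "transforms E (nmem \<sigma>) (accumulate ''edges'' always ''total'' (NConst 0) edge_weight) r2 r3"
    unfolding r3_def
    by (rule transforms_accumulate) (simp_all add: evaluation r2_def r1_def)
  have total: "r3 ''total'' 0 = total"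
    using sum.reindex_bij_betw[OF bij_ed, of w]
    by (simp add: r3_def r2_def total_def lessThan_def)
  obtain y4 where t4: "transforms E (nmem \<sigma>) (tally_voters ''used'' (RConst 0) always edge_weight)
        r3 (r3(''used'' := y4))"
    and y4: "\<forall>i<V. y4 i = 0 + (\<Sum>c | c \<in> approved el (vt i) \<and> True. w (vt i, c))"
    by (rule transforms_tally_voters[where a = "''used''" and r = r3 and v = "\<lambda>_. 0"
          and P = "\<lambda>_. True" and h = "\<lambda>n c. w (n, c)" and e\<^sub>0 = "RConst 0" and b = always and e = edge_weight])
       (simp add: evaluation, simp add: evaluation r3_def r2_def r1_def, erule that, assumption)
  define r4 where "r4 = r3(''used'' := y4)"
  obtain y5 where t5: "transforms E (nmem \<sigma>)
        (tally_voters ''spent'' (RConst 0) (cand_elected edge_cand) edge_weight) r4 (r4(''spent'' := y5))"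
    and y5: "\<forall>i<V. y5 i = 0 + (\<Sum>c | c \<in> approved el (vt i) \<and> c \<in> A. w (vt i, c))"
    by (rule transforms_tally_voters[where a = "''spent''" and r = r4 and v = "\<lambda>_. 0"
          and P = "\<lambda>c. c \<in> A" and h = "\<lambda>n c. w (n, c)" and e\<^sub>0 = "RConst 0"
          and b = "cand_elected edge_cand" and e = edge_weight])
       (simp add: evaluation, simp add: evaluation r4_def r3_def r2_def r1_def, erule that, assumption)
  define r5 where "r5 = r4(''spent'' := y5)"
  obtain y6 where t6: "transforms E (nmem \<sigma>) (tally_cands ''supp'' always edge_weight) r5 (r5(''supp'' := y6))"
    and y6: "\<forall>j<C. True \<longrightarrow> y6 j = (\<Sum>n\<in>approvers el (cd j). w (n, cd j))"
    by (rule transforms_tally_cands[where a = "''supp''" and r = r5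
          and P = "\<lambda>_. True" and h = "\<lambda>n c. w (n, c)" and b = always and e = edge_weight])
       (simp add: evaluation r5_def r4_def r3_def r2_def r1_def, erule that, assumption)
  define r6 where "r6 = r5(''supp'' := y6)"
  have r6: "r6 ''used'' = y4" "r6 ''spent'' = y5" "r6 ''supp'' = y6" "r6 ''total'' 0 = total"
      "r6 ''bad'' 0 = 0" "r6 ''weight'' = rmem \<sigma> ''weight''" "r6 ''strength'' = rmem \<sigma> ''strength''"
    using total by (simp_all add: r6_def r5_def r4_def r3_def r2_def r1_def)
  have used: "y4 i = (\<Sum>c\<in>approved el (vt i). w (vt i, c))" if "i < V" for i
    using y4 that by simp
  have spent: "y5 i = (\<Sum>c\<in>A \<inter> approved el (vt i). w (vt i, c))" if "i < V" for i
  proof -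
    have "{c. c \<in> approved el (vt i) \<and> c \<in> A} = A \<inter> approved el (vt i)" by auto
    then show ?thesis using y5 that by simp
  qed
  have supps: "y6 j = supp el w (cd j)" if "j < C" for j
    using y6 that by (simp add: supp_def)
  obtain y7 where t7: "transforms E (nmem \<sigma>) (report ''edges'' (RLess edge_weight (RConst 0))) r6 (r6(''bad'' := y7))"
    and y7: "0 \<le> y7 0" "y7 0 = 0 \<longleftrightarrow> r6 ''bad'' 0 = 0 \<and> (\<forall>l<E. \<not> w (ev l, ec l) < 0)"
    by (rule transforms_report[where N = "''edges''" and nm = "nmem \<sigma>" and n = E and m = E and r = r6
          and P = "\<lambda>l. w (ev l, ec l) < 0" and b = "RLess edge_weight (RConst 0)"])
       (simp add: evaluation, simp add: evaluation, simp add: evaluation, simp add: evaluation, simp add: r6,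
        simp add: evaluation r6, erule that, assumption+)
  define r7 where "r7 = r6(''bad'' := y7)"
  obtain y8 where t8: "transforms E (nmem \<sigma>)
        (report ''voters'' (RLess (RRead ''strength'' counter) (RRead ''used'' counter))) r7 (r7(''bad'' := y8))"
    and y8: "0 \<le> y8 0" "y8 0 = 0 \<longleftrightarrow> r7 ''bad'' 0 = 0 \<and>
      (\<forall>i<V. \<not> strength el (vt i) < (\<Sum>c\<in>approved el (vt i). w (vt i, c)))"
    by (rule transforms_report[where N = "''voters''" and nm = "nmem \<sigma>" and n = V and m = E and r = r7
          and P = "\<lambda>i. strength el (vt i) < (\<Sum>c\<in>approved el (vt i). w (vt i, c))"
          and b = "RLess (RRead ''strength'' counter) (RRead ''used'' counter)"])
       (simp add: evaluation, simp add: evaluation, simp add: evaluation, simp add: evaluation,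
        simp add: r7_def y7, simp add: evaluation r7_def r6 used, erule that, assumption+)
  define r8 where "r8 = r7(''bad'' := y8)"
  define b9 where "b9 = BAnd (cand_elected edge_cand)
    (RLess (RRead ''spent'' edge_voter) (RRead ''strength'' edge_voter))"
  obtain y9 where t9: "transforms E (nmem \<sigma>) (report ''edges'' b9) r8 (r8(''bad'' := y9))"
    and y9: "0 \<le> y9 0" "y9 0 = 0 \<longleftrightarrow> r8 ''bad'' 0 = 0 \<and>
      (\<forall>l<E. \<not> (ec l \<in> A \<and> (\<Sum>c\<in>A \<inter> approved el (ev l). w (ev l, c)) < strength el (ev l)))"
    by (rule transforms_report[where N = "''edges''" and nm = "nmem \<sigma>" and n = E and m = E and r = r8
          and P = "\<lambda>l. ec l \<in> A \<and> (\<Sum>c\<in>A \<inter> approved el (ev l). w (ev l, c)) < strength el (ev l)"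
          and b = b9])
       (simp add: evaluation, simp add: evaluation, simp add: evaluation, simp add: evaluation,
        simp add: r8_def y8, simp add: evaluation b9_def r8_def r7_def r6 spent, erule that, assumption+)
  define r9 where "r9 = r8(''bad'' := y9)"
  define r10 where "r10 = r9(''level'' := \<lambda>j. if j < V then total else r9 ''level'' j)"
  have t10: "transforms E (nmem \<sigma>) (fill ''voters'' ''level'' (RRead ''total'' (NConst 0))) r9 r10"
    unfolding r10_def
    by (rule transforms_fill) (simp_all add: evaluation r9_def r8_def r7_def r6)
  define r11 where "r11 = r10(''level'' := \<lambda>j. Min (insert (r10 ''level'' j)
    ((\<lambda>l. supp el w (ec l)) ` {l. l < E \<and> ec l \<in> A \<and> nmem \<sigma> ''voter'' l = j})))"
  have t11: "transforms E (nmem \<sigma>)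
      (minimize ''edges'' (cand_elected edge_cand) ''level'' edge_voter (RRead ''supp'' edge_cand)) r10 r11"
    unfolding r11_def
    by (rule transforms_minimize) (simp_all add: evaluation r10_def r9_def r8_def r7_def r6 supps)
  have levels: "r11 ''level'' i = level (vt i)" if "i < V" for i
  proof -
    have "ec ` {l. l < E \<and> ec l \<in> A \<and> nmem \<sigma> ''voter'' l = i} = A \<inter> approved el (vt i)"
      using bij_betw_imp_surj_on[OF bij_edges_of_voter[OF that, of "\<lambda>c. c \<in> A"]] by auto
    then have "(\<lambda>l. supp el w (ec l)) ` {l. l < E \<and> ec l \<in> A \<and> nmem \<sigma> ''voter'' l = i} =
        supp el w ` (A \<inter> approved el (vt i))"
      by (simp only: image_image[symmetric])
    then show ?thesis using that by (simp only: r11_def r10_def level_def fun_upd_same if_True)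
  qed
  have r11: "r11 ''supp'' = y6" "r11 ''total'' 0 = total" "r11 ''bad'' = y9"
      "r11 ''weight'' = rmem \<sigma> ''weight''" "r11 ''strength'' = rmem \<sigma> ''strength''"
    using r6 by (simp_all add: r11_def r10_def r9_def r8_def r7_def)
  define b12 where "b12 = BAnd (cand_elected edge_cand) (BAnd (RLess (RConst 0) edge_weight)
    (RLess (RRead ''level'' edge_voter) (RRead ''supp'' edge_cand)))"
  obtain y12 where t12: "transforms E (nmem \<sigma>) (report ''edges'' b12) r11 (r11(''bad'' := y12))"
    and y12: "0 \<le> y12 0" "y12 0 = 0 \<longleftrightarrow> r11 ''bad'' 0 = 0 \<and>
      (\<forall>l<E. \<not> (ec l \<in> A \<and> 0 < w (ev l, ec l) \<and> level (ev l) < supp el w (ec l)))"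
    by (rule transforms_report[where N = "''edges''" and nm = "nmem \<sigma>" and n = E and m = E and r = r11
          and P = "\<lambda>l. ec l \<in> A \<and> 0 < w (ev l, ec l) \<and> level (ev l) < supp el w (ec l)" and b = b12])
       (simp add: evaluation, simp add: evaluation, simp add: evaluation, simp add: evaluation,
        simp add: r11 y9, simp add: evaluation b12_def r11 supps levels, erule that, assumption+)
  define r12 where "r12 = r11(''bad'' := y12)"
  define r13 where "r13 = r12(''threshold'' := (r12 ''threshold'')(0 := total))"
  have t13: "transforms E (nmem \<sigma>) (RWrite ''threshold'' (NConst 0) (RRead ''total'' (NConst 0))) r12 r13"
    unfolding r13_def by (rule transforms_RWrite) (simp_all add: evaluation r12_def r11)
  define r14 where "r14 = r13(''threshold'' := \<lambda>j. Min (insert (r13 ''threshold'' j)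
    ((\<lambda>l. supp el w (cd l)) ` {l. l < C \<and> cd l \<in> A \<and> 0 = j})))"
  have t14: "transforms E (nmem \<sigma>)
      (minimize ''cands'' (cand_elected counter) ''threshold'' (NConst 0) (RRead ''supp'' counter)) r13 r14"
    unfolding r14_def
    by (rule transforms_minimize) (simp_all add: evaluation r13_def r12_def r11 supps)
  have r14: "r14 ''threshold'' 0 = threshold"
  proof -
    have "cd ` {l. l < C \<and> cd l \<in> A \<and> (0::nat) = 0} = A"
      using full_subset[OF full_A] bij_betw_imp_surj_on[OF bij_cd] by auto
    then have "(\<lambda>l. supp el w (cd l)) ` {l. l < C \<and> cd l \<in> A \<and> (0::nat) = 0} = supp el w ` A"
      by (simp only: image_image[symmetric])
    then show ?thesis by (simp only: r14_def r13_def threshold_def fun_upd_same)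
  qed
  have r14': "r14 ''supp'' = y6" "r14 ''bad'' = y12"
      "r14 ''weight'' = rmem \<sigma> ''weight''" "r14 ''strength'' = rmem \<sigma> ''strength''"
    using r11 by (simp_all add: r14_def r13_def r12_def)
  define e15 where "e15 = RMinus (RConst 0)
    (RTimes edge_weight (RDivide (RRead ''threshold'' (NConst 0)) (RRead ''supp'' edge_cand)))"
  obtain y15 where t15: "transforms E (nmem \<sigma>)
        (tally_voters ''slack'' (RRead ''strength'' counter) (cand_elected edge_cand) e15) r14 (r14(''slack'' := y15))"
    and y15: "\<forall>i<V. y15 i = strength el (vt i) +
      (\<Sum>c | c \<in> approved el (vt i) \<and> c \<in> A. 0 - w (vt i, c) * (threshold / supp el w c))"
    by (rule transforms_tally_voters[where a = "''slack''" and r = r14 and v = "strength el"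
          and P = "\<lambda>c. c \<in> A" and h = "\<lambda>n c. 0 - w (n, c) * (threshold / supp el w c)"
          and e\<^sub>0 = "RRead ''strength'' counter" and b = "cand_elected edge_cand" and e = e15])
       (simp add: evaluation r14', simp add: evaluation e15_def r14 r14' supps, erule that, assumption)
  define r15 where "r15 = r14(''slack'' := y15)"
  have slacks: "y15 i = slack_tally (vt i)" if "i < V" for i
    using y15 that by (simp add: slack_tally_def)
  obtain y16 where t16: "transforms E (nmem \<sigma>)
        (tally_cands ''prescore'' (BNot (cand_elected edge_cand)) (RRead ''slack'' edge_voter))
        r15 (r15(''prescore'' := y16))"
    and y16: "\<forall>j<C. cd j \<notin> A \<longrightarrow> y16 j = (\<Sum>n\<in>approvers el (cd j). slack_tally n)"
    by (rule transforms_tally_cands[where a = "''prescore''" and r = r15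
          and P = "\<lambda>c. c \<notin> A" and h = "\<lambda>n c. slack_tally n" and b = "BNot (cand_elected edge_cand)"
          and e = "RRead ''slack'' edge_voter"])
       (simp add: evaluation r15_def slacks, erule that, assumption)
  define r16 where "r16 = r15(''prescore'' := y16)"
  \<comment> \<open>The array \<open>y16\<close> is known only at unelected candidates, which
    suffices since \<open>b17\<close> is a conjunction with this very guard.\<close>
  define b17 where "b17 = BAnd (BNot (cand_elected counter))
    (RLess (RRead ''threshold'' (NConst 0)) (RRead ''prescore'' counter))"
  obtain y17 where t17: "transforms E (nmem \<sigma>) (report ''cands'' b17) r16 (r16(''bad'' := y17))"
    and y17: "0 \<le> y17 0" "y17 0 = 0 \<longleftrightarrow> r16 ''bad'' 0 = 0 \<and>
      (\<forall>j<C. \<not> (cd j \<notin> A \<and> threshold < (\<Sum>n\<in>approvers el (cd j). slack_tally n)))"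
    by (rule transforms_report[where N = "''cands''" and nm = "nmem \<sigma>" and n = C and m = E and r = r16
          and P = "\<lambda>j. cd j \<notin> A \<and> threshold < (\<Sum>n\<in>approvers el (cd j). slack_tally n)" and b = b17])
       (simp add: evaluation, simp add: evaluation, simp add: evaluation, simp add: evaluation,
        simp add: r16_def r15_def r14' y12,
        use y16 in \<open>simp add: evaluation b17_def r16_def r15_def r14 cong: conj_cong\<close>, erule that, assumption+)
  have "transforms E (nmem \<sigma>) (foldr Seq test_steps Skip) (rmem \<sigma>) (r16(''bad'' := y17))"
    unfolding test_steps_def foldr.simps o_apply id_apply b9_def[symmetric] b12_def[symmetric]
      b17_def[symmetric] e15_def[symmetric]
    by (intro transforms_Seq[OF t1] transforms_Seq[OF t2] transforms_Seq[OF t3]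
        transforms_Seq[OF t4[folded r4_def]] transforms_Seq[OF t5[folded r5_def]]
        transforms_Seq[OF t6[folded r6_def]] transforms_Seq[OF t7[folded r7_def]]
        transforms_Seq[OF t8[folded r8_def]] transforms_Seq[OF t9[folded r9_def]]
        transforms_Seq[OF t10] transforms_Seq[OF t11] transforms_Seq[OF t12[folded r12_def]]
        transforms_Seq[OF t13] transforms_Seq[OF t14] transforms_Seq[OF t15[folded r15_def]]
        transforms_Seq[OF t16[folded r16_def]] transforms_Seq[OF t17] transforms_Skip edges_pos)
  moreover have "y17 0 = 0 \<longleftrightarrow> passes"
  proof -
    have "r16 ''bad'' = y12" "r11 ''bad'' = y9" "r8 ''bad'' = y8" "r7 ''bad'' = y7" "r6 ''bad'' 0 = 0"
      using r6 r11 r14' by (simp_all add: r16_def r15_def r8_def r7_def)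
    then show ?thesis
      unfolding passes_def all_edges[symmetric] all_voters[symmetric] all_cands[symmetric]
      by (simp only: y17(2) y12(2) y9(2) y8(2) y7(2) simp_thms conj_assoc)
  qed
  ultimately show ?thesis using that[of "r16(''bad'' := y17)"] y17(1) by simp
qed

text \<open>Feasibility is split off first. Only for feasible weights does \<open>total\<close>
  bound the supports, and with it \<open>level\<close>, \<open>threshold\<close> and
  \<open>slack_tally\<close> get their intended meaning.\<close>

lemma passes_iff: "passes \<longleftrightarrow> feasible el w \<and> balanced el A w \<and> score_condition el A w"
proof -
  note AC = full_subset[OF full_A]
  define F where "F \<longleftrightarrow> (\<forall>n. \<forall>c\<in>approved el n. \<not> w (n, c) < 0) \<and>
    (\<forall>n\<in>voters el. \<not> strength el n < (\<Sum>c\<in>approved el n. w (n, c)))"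
  have F: "F \<longleftrightarrow> feasible el w"
    unfolding F_def feasible_def approved_def not_less by auto
  have "(\<forall>n. \<forall>c\<in>approved el n. \<not> (c \<in> A \<and> (\<Sum>c\<in>A \<inter> approved el n. w (n, c)) < strength el n)) \<and>
    (\<forall>n. \<forall>c\<in>approved el n. \<not> (c \<in> A \<and> 0 < w (n, c) \<and> level n < supp el w c)) \<and>
    (\<forall>c\<in>cands el. \<not> (c \<notin> A \<and> threshold < (\<Sum>n\<in>approvers el c. slack_tally n))) \<longleftrightarrow>
    exhaustive A w \<and> concentrated A w \<and> score_condition el A w" if f: "feasible el w"
  proof -
    have le: "(\<Sum>c\<in>A \<inter> approved el n. w (n, c)) \<le> strength el n" if "n \<in> voters el" for n
      by (intro feasible_sum_le[OF f that]) simp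
    have exh: "(\<forall>n. \<forall>c\<in>approved el n. \<not> (c \<in> A \<and> (\<Sum>c\<in>A \<inter> approved el n. w (n, c)) < strength el n))
        \<longleftrightarrow> exhaustive A w"
    proof
      assume *: "\<forall>n. \<forall>c\<in>approved el n. \<not> (c \<in> A \<and> (\<Sum>c\<in>A \<inter> approved el n. w (n, c)) < strength el n)"
      have "(\<Sum>c\<in>A \<inter> approved el n. w (n, c)) = strength el n"
        if n: "n \<in> voters el" "A \<inter> approved el n \<noteq> {}" for n
      proof -
        obtain c where "c \<in> A" "c \<in> approved el n" using n by blast
        then show ?thesis using * le[OF n(1)] by fastforce
      qed
      then show "exhaustive A w" using f by (simp add: exhaustive_def)
    next
      assume "exhaustive A w"
      then show "\<forall>n. \<forall>c\<in>approved el n. \<not> (c \<in> A \<and> (\<Sum>c\<in>A \<inter> approved el n. w (n, c)) < strength el n)"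
        using in_approved_voter by (fastforce simp: exhaustive_def)
    qed
    \<comment> \<open>The edges into \<open>c\<close> are among all edges, and the other weights are
      non-negative.\<close>
    have total: "supp el w c \<le> total" for c
    proof -
      have "supp el w c = (\<Sum>e\<in>(\<lambda>n. (n, c)) ` approvers el c. w e)"
        by (simp add: supp_def sum.reindex inj_on_def)
      also have "\<dots> \<le> total"
        unfolding total_def using f finite_edges
        by (intro sum_mono2) (auto simp: approvers_def feasible_def)
      finally show ?thesis .
    qed
    have conc: "(\<forall>n. \<forall>c\<in>approved el n. \<not> (c \<in> A \<and> 0 < w (n, c) \<and> level n < supp el w c))
        \<longleftrightarrow> concentrated A w"
    proof -
      have "level n < supp el w c \<longleftrightarrow> (\<exists>d\<in>A \<inter> approved el n. supp el w d < supp el w c)" for n c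
        using total[of c] by (auto simp: level_def Min_less_iff)
      then show ?thesis by (auto simp: concentrated_def not_less[symmetric])
    qed
    have thr: "threshold = min_supp el w A"
    proof -
      obtain d where "d \<in> A" "min_supp el w A = supp el w d" using min_supp_in[OF full_A] by auto
      then have "min_supp el w A \<le> total" using total by simp
      then show ?thesis
        using full_finite[OF full_A] full_nonempty[OF full_A] by (simp add: threshold_def min_supp_def)
    qed
    have slack: "slack_tally n = slack el A w n threshold" for n
    proof -
      have "min 1 (threshold / supp el w c) = threshold / supp el w c" if "c \<in> A" for c
        using min_supp_le[OF full_A that, of w] min_supp_nonneg[OF full_A f]
        by (cases "supp el w c = 0") (auto simp: thr min_def field_simps)
      then have "(\<Sum>c\<in>A \<inter> approved el n. w (n, c) * min 1 (threshold / supp el w c)) =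
          (\<Sum>c\<in>A \<inter> approved el n. w (n, c) * (threshold / supp el w c))"
        by (intro sum.cong) auto
      moreover have "{c. c \<in> approved el n \<and> c \<in> A} = A \<inter> approved el n" by auto
      ultimately show ?thesis by (simp add: slack_tally_def slack_def sum_negf)
    qed
    have "(\<forall>c\<in>cands el. \<not> (c \<notin> A \<and> threshold < (\<Sum>n\<in>approvers el c. slack_tally n)))
        \<longleftrightarrow> score_condition el A w"
      unfolding score_condition_iff_prescore[OF full_A f] prescore_def slack thr by (auto simp: not_less)
    then show ?thesis using exh conc by blast
  qed
  moreover have "passes \<longleftrightarrow> F \<and>
    ((\<forall>n. \<forall>c\<in>approved el n. \<not> (c \<in> A \<and> (\<Sum>c\<in>A \<inter> approved el n. w (n, c)) < strength el n)) \<and>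
    (\<forall>n. \<forall>c\<in>approved el n. \<not> (c \<in> A \<and> 0 < w (n, c) \<and> level n < supp el w c)) \<and>
    (\<forall>c\<in>cands el. \<not> (c \<notin> A \<and> threshold < (\<Sum>n\<in>approvers el c. slack_tally n))))"
    unfolding passes_def F_def by (simp only: conj_assoc)
  ultimately show ?thesis unfolding F balanced_iff[OF AC] by blast
qed

lemma test_prog_correct:
  "\<exists>t \<sigma>'. exec test_prog \<sigma> t \<sigma>' \<and> t \<le> cost_factor test_prog * E \<and>
     (accepts \<sigma>' \<longleftrightarrow> feasible el w \<and> balanced el A w \<and> score_condition el A w)"
proof -
  obtain r where r: "transforms E (nmem \<sigma>) (foldr Seq test_steps Skip) (rmem \<sigma>) r"
    "0 \<le> r ''bad'' 0" "r ''bad'' 0 = 0 \<longleftrightarrow> passes" using transforms_test_steps by blast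
  \<comment> \<open>Presents the initial state in the form required by \<open>transforms\<close>,
    whose loop counter array is arbitrary.\<close>
  have "\<lparr>nmem = (nmem \<sigma>)(''i'' := nmem \<sigma> ''i''), rmem = rmem \<sigma>\<rparr> = \<sigma>" by simp
  then obtain t x where t: "exec (foldr Seq test_steps Skip) \<sigma> t \<lparr>nmem = (nmem \<sigma>)(''i'' := x), rmem = r\<rparr>"
    "t \<le> cost_factor (foldr Seq test_steps Skip) * E"
    using r(1) unfolding transforms_def by metis
  define \<tau> where "\<tau> = \<lparr>nmem = (nmem \<sigma>)(''i'' := x), rmem = r\<rparr>"
  define b where "b = RLess (RConst 0) (RRead ''bad'' (NConst 0))"
  define set where "set k = NWrite ''accept'' (NConst 0) (NConst k)" for k
  have accept_write: "exec (set k) \<tau> 3 (nwrite ''accept'' 0 k \<tau>)" for k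
    using exec.NWrite[of "''accept''" "NConst 0" "NConst k" \<tau>] by (simp add: set_def eval_nat_numeral)
  have b: "bval b \<tau> \<longleftrightarrow> \<not> passes" using r(2,3) by (auto simp: b_def \<tau>_def)
  have "\<exists>\<sigma>'. exec (Cond b (set 0) (set 1)) \<tau> (1 + bcost b + 3) \<sigma>' \<and> (accepts \<sigma>' \<longleftrightarrow> passes)"
  proof (cases passes)
    case True
    then show ?thesis
      using exec.CondFalse[OF _ accept_write[of 1], of b "set 0"] b by (force simp: accepts_def nwrite_def)
  next
    case False
    then show ?thesis
      using exec.CondTrue[OF _ accept_write[of 0], of b "set 1"] b by (force simp: accepts_def nwrite_def)
  qed
  then obtain \<sigma>' where \<sigma>': "exec (Cond b (set 0) (set 1)) \<tau> (1 + bcost b + 3) \<sigma>'" "accepts \<sigma>' \<longleftrightarrow> passes"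
    by blast
  have prog: "test_prog = Seq (foldr Seq test_steps Skip) (Cond b (set 0) (set 1))"
    by (simp add: test_prog_def b_def set_def)
  have "1 + t + (1 + bcost b + 3) \<le> cost_factor test_prog * E"
  proof -
    have "1 + (1 + bcost b + 3) \<le> cost_factor (Cond b (set 0) (set 1)) * E"
      using edges_pos by (intro order_trans[OF _ mult_le_mono2[OF edges_pos]]) (simp add: set_def)
    then show ?thesis using t(2) unfolding prog by (simp add: add_mult_distrib)
  qed
  then show ?thesis
    using exec.Seq[OF t(1)[folded \<tau>_def] \<sigma>'(1)] \<sigma>'(2) unfolding prog passes_iff by blast
qed

end

theorem theorem8:
  shows
    "(\<forall>(el :: ('n, 'c) election) A w.
        election_instance el \<and> full el A \<and> balanced el A w \<and> score_condition el A w \<longrightarrow>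
        PJR el A \<and> maximin_approx el 3.15 A w) \<and>
     (\<exists>prog K. \<forall>(el :: ('n, 'c) election) A w \<sigma>.
        election_instance el \<and> full el A \<and> encodes \<sigma> el A w \<longrightarrow>
        (\<exists>t \<sigma>'. exec prog \<sigma> t \<sigma>' \<and> t \<le> K * card (edges el) \<and>
           (accepts \<sigma>' \<longleftrightarrow> feasible el w \<and> balanced el A w \<and> score_condition el A w))) \<and>
     (\<forall>el :: ('n, 'c) election. election_instance el \<longrightarrow>
        (\<exists>A w. greedy_output el A w) \<and>
        (\<forall>A w. greedy_output el A w \<longrightarrow>
           full el A \<and> feasible el w \<and> balanced el A w \<and> score_condition el A w))"
proof (intro conjI)
  show "\<forall>(el :: ('n, 'c) election) A w.
      election_instance el \<and> full el A \<and> balanced el A w \<and> score_condition el A w \<longrightarrow>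
      PJR el A \<and> maximin_approx el 3.15 A w"
  proof (intro allI impI, elim conjE)
    fix el :: "('n, 'c) election" and A w
    assume "election_instance el" and A: "full el A" "balanced el A w" "score_condition el A w"
    then interpret approval_election el by unfold_locales
    have w: "feasible el w" using A by (auto simp: balanced_iff[OF full_subset] exhaustive_def)
    \<comment> \<open>The support of \<open>A\<close> is non-negative, so the factor 3 may be raised
      to 3.15.\<close>
    have "min_supp el v B \<le> 3.15 * min_supp el w A" if "full el B" "feasible el v" for B v
      using score_condition_approx[OF A that] min_supp_nonneg[OF A(1) w] by (simp add: power2_eq_square)
    then show "PJR el A \<and> maximin_approx el 3.15 A w"
      using score_condition_PJR[OF A(1) w A(3)] A w by (simp add: maximin_approx_def)
  qed
  \<comment> \<open>The witnesses \<open>test_prog\<close> and \<open>cost_factor test_prog\<close>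
    are fixed before the election, as the order of the quantifiers demands.\<close>
  have "\<exists>t \<sigma>'. exec test_prog \<sigma> t \<sigma>' \<and> t \<le> cost_factor test_prog * card (edges el) \<and>
      (accepts \<sigma>' \<longleftrightarrow> feasible el w \<and> balanced el A w \<and> score_condition el A w)"
    if inst: "election_instance el" "full el A" and enc: "encodes \<sigma> el A w" for el :: "('n, 'c) election" and A w \<sigma>
  proof -
    from enc obtain vt cd ed where "encoded_election el \<sigma> A w vt cd ed"
      unfolding encodes_def encoded_election_def encoded_election_axioms_def approval_election_def
      using inst by blast
    then show ?thesis by (rule encoded_election.test_prog_correct)
  qed
  then show "\<exists>prog K. \<forall>(el :: ('n, 'c) election) A w \<sigma>.
      election_instance el \<and> full el A \<and> encodes \<sigma> el A w \<longrightarrow>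
      (\<exists>t \<sigma>'. exec prog \<sigma> t \<sigma>' \<and> t \<le> K * card (edges el) \<and>
         (accepts \<sigma>' \<longleftrightarrow> feasible el w \<and> balanced el A w \<and> score_condition el A w))"
    by blast
  show "\<forall>el :: ('n, 'c) election. election_instance el \<longrightarrow>
      (\<exists>A w. greedy_output el A w) \<and>
      (\<forall>A w. greedy_output el A w \<longrightarrow>
         full el A \<and> feasible el w \<and> balanced el A w \<and> score_condition el A w)"
  proof (intro allI impI)
    fix el :: "('n, 'c) election"
    assume "election_instance el"
    then interpret approval_election el by unfold_locales
    show "(\<exists>A w. greedy_output el A w) \<and> (\<forall>A w. greedy_output el A w \<longrightarrow>
        full el A \<and> feasible el w \<and> balanced el A w \<and> score_condition el A w)"
      using greedy_output_exists greedy_output_correct by blast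
  qed
qed

end
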